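(* There exists a sequence $\{K_n\}_{n\ge1}$ of link types in $S^3$ such that for every $n\ge 1$ the link type $K_n$ has a braid representative $\beta_n$ of minimal braid index (i.e. the number of strands of $\beta_n$ is the smallest among all braids whose closure is $K_n$) with $$\mathrm{nb}(\beta_n)-\mathrm{nb}(K_n)=n.$$
   Context: $B_m$ is the braid group on $m$ strands with Artin generators $\sigma_1,\dots,\sigma_{m-1}$. For $1\le i<j\le m$ the band generator is $a_{ij}=(\sigma_{j-1}\sigma_{j-2}\cdots\sigma_{i+1})\,\sigma_i\,(\sigma_{j-1}\sigma_{j-2}\cdots\sigma_{i+1})^{-1}$. A braid word means a word in the letters $a_{ij}^{\pm1}$; the letters $a_{ij}^{-1}$ are negative bands. For a braid word $W$, $\mathrm{nb}(W)$ is the number of negative bands appearing in $W$; for a braid $\beta\in B_m$, $\mathrm{nb}(\beta)=\min\{\mathrm{nb}(W): W\text{ represents }\beta\}$. A braid representative of a link type $K\subset S^3$ is a braid (on any number of strands) whose closure is $K$, and $\mathrm{nb}(K)=\min\{\mathrm{nb}(\beta):\beta\text{ is a braid representative of }K\}$. *)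

theory Defs
  imports
    "HOL-Analysis.Analysis"
    "HOL-Algebra.Group"
    "HOL-Combinatorics.Orbits"
begin

section \<open>The braid group\<close>

text \<open>
  \<^term>\<open>(i, True)\<close> stands for \<open>\<sigma>\<^sub>i\<close> and \<^term>\<open>(i, False)\<close> for its inverse. Strands are numbered
  from 1 to \<open>m\<close>.
\<close>

type_synonym letter = "nat \<times> bool"

definition artin_words :: "nat \<Rightarrow> letter list set" where
  "artin_words m = lists ({1..<m} \<times> UNIV)"

inductive braid_eq :: "nat \<Rightarrow> letter list \<Rightarrow> letter list \<Rightarrow> bool" for m :: nat where
  refl: "w \<in> artin_words m \<Longrightarrow> braid_eq m w w"
| sym: "braid_eq m u v \<Longrightarrow> braid_eq m v u"
| trans: "braid_eq m u v \<Longrightarrow> braid_eq m v w \<Longrightarrow> braid_eq m u w"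
| append: "braid_eq m u u' \<Longrightarrow> braid_eq m v v' \<Longrightarrow> braid_eq m (u @ v) (u' @ v')"
| cancel: "1 \<le> i \<Longrightarrow> i < m \<Longrightarrow> braid_eq m [(i, s), (i, \<not> s)] []"
| far: "1 \<le> i \<Longrightarrow> i + 2 \<le> j \<Longrightarrow> j < m \<Longrightarrow>
    braid_eq m [(i, True), (j, True)] [(j, True), (i, True)]"
| near: "1 \<le> i \<Longrightarrow> i + 1 < m \<Longrightarrow>
    braid_eq m [(i, True), (i + 1, True), (i, True)] [(i + 1, True), (i, True), (i + 1, True)]"

definition braid_rel :: "nat \<Rightarrow> (letter list \<times> letter list) set" where
  "braid_rel m = {(u, v). braid_eq m u v}"

definition braid_group :: "nat \<Rightarrow> letter list set monoid" where
  "braid_group m =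
     \<lparr>carrier = artin_words m // braid_rel m,
      mult = (\<lambda>A B. \<Union>u\<in>A. \<Union>v\<in>B. braid_rel m `` {u @ v}),
      one = braid_rel m `` {[]}\<rparr>"

definition artin_gen :: "nat \<Rightarrow> nat \<Rightarrow> letter list set" where
  "artin_gen m i = braid_rel m `` {[(i, True)]}"

definition braid_prod :: "nat \<Rightarrow> letter list set list \<Rightarrow> letter list set" where
  "braid_prod m xs = foldr (mult (braid_group m)) xs \<one>\<^bsub>braid_group m\<^esub>"

lemma braid_eq_words: "braid_eq m u v \<Longrightarrow> u \<in> artin_words m \<and> v \<in> artin_words m"
  by (induction rule: braid_eq.induct) (auto simp: artin_words_def)

lemma artin_words_append [simp]:
  "u @ v \<in> artin_words m \<longleftrightarrow> u \<in> artin_words m \<and> v \<in> artin_words m"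
  by (auto simp: artin_words_def)

lemma artin_words_Nil [simp]: "[] \<in> artin_words m"
  by (auto simp: artin_words_def)

lemma equiv_braid_rel: "equiv (artin_words m) (braid_rel m)"
  by (rule equivI)
     (auto simp: braid_rel_def refl_on_def sym_def trans_def
           dest: braid_eq_words intro: braid_eq.intros)

lemma braid_class_eq_iff:
  "u \<in> artin_words m \<Longrightarrow> v \<in> artin_words m \<Longrightarrow>
     braid_rel m `` {u} = braid_rel m `` {v} \<longleftrightarrow> braid_eq m u v"
  using eq_equiv_class_iff[OF equiv_braid_rel] by (auto simp: braid_rel_def)

lemma braid_mult_class:
  assumes "u \<in> artin_words m" "v \<in> artin_words m"
  shows "braid_rel m `` {u} \<otimes>\<^bsub>braid_group m\<^esub> braid_rel m `` {v} = braid_rel m `` {u @ v}"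
proof -
  have "congruent2 (braid_rel m) (braid_rel m) (\<lambda>u v. braid_rel m `` {u @ v})"
    by (rule congruent2I')
       (auto simp: braid_rel_def braid_class_eq_iff[unfolded braid_rel_def]
             dest: braid_eq_words intro: braid_eq.append braid_eq.sym braid_eq.trans)
  from UN_equiv_class2[OF equiv_braid_rel equiv_braid_rel this assms]
  show ?thesis by (simp add: braid_group_def)
qed

lemma braid_carrierE:
  assumes "\<beta> \<in> carrier (braid_group m)"
  obtains u where "u \<in> artin_words m" "\<beta> = braid_rel m `` {u}"
  using assms by (auto simp: braid_group_def elim: quotientE)

lemma braid_class_carrier: "u \<in> artin_words m \<Longrightarrow> braid_rel m `` {u} \<in> carrier (braid_group m)"
  by (auto simp: braid_group_def intro: quotientI)

lemma braid_one: "\<one>\<^bsub>braid_group m\<^esub> = braid_rel m `` {[]}"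
  by (simp add: braid_group_def)

lemma braid_inverse_word:
  "u \<in> artin_words m \<Longrightarrow> \<exists>v \<in> artin_words m. braid_eq m (v @ u) []"
proof (induction u)
  case Nil
  then show ?case by (auto intro!: bexI[of _ "[]"] braid_eq.refl)
next
  case (Cons l u)
  then obtain v where v: "v \<in> artin_words m" "braid_eq m (v @ u) []"
    by (auto simp: artin_words_def)
  obtain i s where l: "l = (i, s)" by (cases l)
  have i: "1 \<le> i" "i < m" and u: "u \<in> artin_words m"
    using Cons.prems l by (auto simp: artin_words_def)
  have c: "braid_eq m [(i, \<not> s), (i, s)] []"
    using braid_eq.cancel[OF i, of "\<not> s"] by simp
  have "braid_eq m ((v @ [(i, \<not> s), (i, s)]) @ u) ((v @ []) @ u)"
    by (intro braid_eq.append braid_eq.refl v u c)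
  then have "braid_eq m ((v @ [(i, \<not> s)]) @ l # u) []"
    using v by (auto simp: l intro: braid_eq.trans)
  moreover have "v @ [(i, \<not> s)] \<in> artin_words m"
    using v i by (auto simp: artin_words_def)
  ultimately show ?case by blast
qed

lemma group_braid_group: "group (braid_group m)"
proof (rule groupI)
  show "\<one>\<^bsub>braid_group m\<^esub> \<in> carrier (braid_group m)"
    by (simp add: braid_one braid_class_carrier)
next
  fix x assume "x \<in> carrier (braid_group m)"
  then obtain u where u: "u \<in> artin_words m" "x = braid_rel m `` {u}"
    by (rule braid_carrierE)
  show "\<one>\<^bsub>braid_group m\<^esub> \<otimes>\<^bsub>braid_group m\<^esub> x = x"
    using u by (simp add: braid_one braid_mult_class)
  obtain v where v: "v \<in> artin_words m" "braid_eq m (v @ u) []"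
    using braid_inverse_word u by blast
  show "\<exists>y\<in>carrier (braid_group m). y \<otimes>\<^bsub>braid_group m\<^esub> x = \<one>\<^bsub>braid_group m\<^esub>"
    using u v by (intro bexI[of _ "braid_rel m `` {v}"])
      (auto simp: braid_one braid_mult_class braid_class_eq_iff braid_class_carrier)
qed (auto elim!: braid_carrierE simp: braid_mult_class braid_class_carrier)


section \<open>Negative bands\<close>

definition band :: "nat \<Rightarrow> nat \<Rightarrow> nat \<Rightarrow> letter list set" where
  "band m i j =
     (let c = braid_prod m (map (artin_gen m) (rev [i + 1..<j]))
      in c \<otimes>\<^bsub>braid_group m\<^esub> artin_gen m i \<otimes>\<^bsub>braid_group m\<^esub> inv\<^bsub>braid_group m\<^esub> c)"

text \<open>\<^term>\<open>(i, j, s)\<close> stands for \<open>a\<^sub>i\<^sub>j\<close> or, if \<open>s\<close> is \<^const>\<open>False\<close>, for its inverse.\<close>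

type_synonym band_letter = "nat \<times> nat \<times> bool"

definition band_words :: "nat \<Rightarrow> band_letter list set" where
  "band_words m = lists {(i, j, s). 1 \<le> i \<and> i < j \<and> j \<le> m}"

definition band_value :: "nat \<Rightarrow> band_letter list \<Rightarrow> letter list set" where
  "band_value m W = braid_prod m
     (map (\<lambda>(i, j, s). if s then band m i j else inv\<^bsub>braid_group m\<^esub> (band m i j)) W)"

definition nb_word :: "band_letter list \<Rightarrow> nat" where
  "nb_word W = length (filter (\<lambda>(i, j, s). \<not> s) W)"

definition nb_braid :: "nat \<Rightarrow> letter list set \<Rightarrow> nat" where
  "nb_braid m \<beta> = (LEAST k. \<exists>W \<in> band_words m. band_value m W = \<beta> \<and> nb_word W = k)"


section \<open>Oriented links in the 3-sphere\<close>

definition S3 :: "(complex \<times> complex) set" where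
  "S3 = sphere 0 1"

type_synonym closed_curve = "real \<Rightarrow> complex \<times> complex"

text \<open>
  A link is given by parametrisations of its components; only their values on \<open>[0,1]\<close> matter.
\<close>

definition oriented_links :: "closed_curve set set" where
  "oriented_links = {L. finite L \<and> L \<noteq> {} \<and>
     (\<forall>\<gamma>\<in>L. simple_path \<gamma> \<and> pathfinish \<gamma> = pathstart \<gamma> \<and> path_image \<gamma> \<subseteq> S3) \<and>
     (\<forall>\<gamma>\<in>L. \<forall>\<delta>\<in>L. \<gamma> \<noteq> \<delta> \<longrightarrow> path_image \<gamma> \<inter> path_image \<delta> = {})}"

text \<open>
  Two parametrisations of the same oriented closed curve differ by an orientation preserving
  homeomorphism of the circle \<open>\<real>/\<int>\<close>; \<open>\<phi>\<close> is a lift of that homeomorphism to the real line.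
\<close>

definition same_oriented_curve :: "closed_curve \<Rightarrow> closed_curve \<Rightarrow> bool" where
  "same_oriented_curve \<gamma> \<delta> \<longleftrightarrow>
     (\<exists>\<phi> :: real \<Rightarrow> real. continuous_on UNIV \<phi> \<and> strict_mono \<phi> \<and> (\<forall>s. \<phi> (s + 1) = \<phi> s + 1) \<and>
        (\<forall>s. \<delta> (frac s) = \<gamma> (frac (\<phi> s))))"

text \<open>Final map of an ambient isotopy of the 3-sphere.\<close>

definition isotopic_to_id :: "(complex \<times> complex \<Rightarrow> complex \<times> complex) \<Rightarrow> bool" where
  "isotopic_to_id h \<longleftrightarrow>
     homotopic_with_canon (\<lambda>f. \<exists>g. homeomorphism S3 S3 f g) S3 S3 id h"

definition link_isotopic :: "closed_curve set \<Rightarrow> closed_curve set \<Rightarrow> bool" where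
  "link_isotopic L L' \<longleftrightarrow>
     (\<exists>h f. isotopic_to_id h \<and> bij_betw f L L' \<and>
        (\<forall>\<gamma>\<in>L. same_oriented_curve (h \<circ> \<gamma>) (f \<gamma>)))"

lemma same_oriented_curve_refl: "same_oriented_curve \<gamma> \<gamma>"
  unfolding same_oriented_curve_def by (rule exI[of _ "\<lambda>x. x"]) (auto simp: strict_mono_def)

lemma same_oriented_curve_trans:
  assumes "same_oriented_curve \<gamma> \<delta>" "same_oriented_curve \<delta> \<epsilon>"
  shows "same_oriented_curve \<gamma> \<epsilon>"
proof -
  from assms obtain \<phi> \<psi> :: "real \<Rightarrow> real"
    where \<phi>: "continuous_on UNIV \<phi>" "strict_mono \<phi>" "\<forall>s. \<phi> (s + 1) = \<phi> s + 1"
          "\<forall>s. \<delta> (frac s) = \<gamma> (frac (\<phi> s))"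
      and \<psi>: "continuous_on UNIV \<psi>" "strict_mono \<psi>" "\<forall>s. \<psi> (s + 1) = \<psi> s + 1"
          "\<forall>s. \<epsilon> (frac s) = \<delta> (frac (\<psi> s))"
    unfolding same_oriented_curve_def by blast
  have "continuous_on UNIV (\<phi> \<circ> \<psi>)"
    by (intro continuous_on_compose \<psi> continuous_on_subset[OF \<phi>(1)]) auto
  then show ?thesis
    unfolding same_oriented_curve_def using \<phi> \<psi>
    by (intro exI[of _ "\<phi> \<circ> \<psi>"]) (auto simp: strict_mono_def)
qed

lemma lift_add_nat:
  assumes "\<forall>s. \<phi> (s + 1) = \<phi> s + (1::real)"
  shows "\<phi> (s + real n) = \<phi> s + real n"
proof (induction n)
  case (Suc n)
  have "\<phi> (s + real (Suc n)) = \<phi> ((s + real n) + 1)" by (simp add: algebra_simps)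
  also have "\<dots> = \<phi> (s + real n) + 1" using assms by blast
  finally show ?case using Suc by simp
qed simp

lemma same_oriented_curve_sym:
  assumes "same_oriented_curve \<gamma> \<delta>"
  shows "same_oriented_curve \<delta> \<gamma>"
proof -
  from assms obtain \<phi> :: "real \<Rightarrow> real"
    where \<phi>: "continuous_on UNIV \<phi>" "strict_mono \<phi>" "\<forall>s. \<phi> (s + 1) = \<phi> s + 1"
          "\<forall>s. \<delta> (frac s) = \<gamma> (frac (\<phi> s))"
    unfolding same_oriented_curve_def by blast
  have inj: "inj \<phi>" using \<phi>(2) by (rule strict_mono_imp_inj_on)
  have "\<exists>x. \<phi> x = y" for y
  proof -
    obtain n :: nat where n: "\<bar>y - \<phi> 0\<bar> \<le> real n" using real_arch_simple by blast
    have 1: "\<phi> (real n) = \<phi> 0 + n" using lift_add_nat[OF \<phi>(3), of 0 n] by simp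
    have 2: "\<phi> (- real n) = \<phi> 0 - n" using lift_add_nat[OF \<phi>(3), of "- real n" n] by simp
    have "\<exists>x\<ge>- real n. x \<le> real n \<and> \<phi> x = y"
      by (rule IVT') (use n 1 2 in \<open>auto intro: continuous_on_subset[OF \<phi>(1)]\<close>)
    then show ?thesis by blast
  qed
  then have surj: "surj \<phi>" by (metis surjI)
  define \<psi> where "\<psi> = inv_into UNIV \<phi>"
  have \<psi>1: "\<phi> (\<psi> y) = y" for y using surj by (simp add: \<psi>_def surj_f_inv_f)
  have \<psi>2: "\<psi> (\<phi> y) = y" for y using inj by (simp add: \<psi>_def)
  have less: "\<psi> x < \<psi> y" if "x < y" for x y
    using that \<psi>1[of x] \<psi>1[of y] strict_mono_less[OF \<phi>(2), of "\<psi> x" "\<psi> y"] by simp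
  have "continuous_on (\<phi> ` UNIV) \<psi>"
    by (rule continuous_on_inverse_open) (use \<phi>(1) \<psi>2 in auto)
  then have "continuous_on UNIV \<psi>" using surj by simp
  moreover have "\<psi> (s + 1) = \<psi> s + 1" for s
    using \<psi>2[of "\<psi> s + 1"] \<phi>(3)[rule_format, of "\<psi> s"] \<psi>1[of s] by simp
  moreover have "\<gamma> (frac s) = \<delta> (frac (\<psi> s))" for s
    using \<phi>(4)[rule_format, of "\<psi> s"] \<psi>1[of s] by simp
  ultimately show ?thesis
    unfolding same_oriented_curve_def using less
    by (intro exI[of _ \<psi>]) (auto simp: strict_mono_def)
qed

lemma same_oriented_curve_compose:
  "same_oriented_curve \<gamma> \<delta> \<Longrightarrow> same_oriented_curve (h \<circ> \<gamma>) (h \<circ> \<delta>)"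
  unfolding same_oriented_curve_def by auto

lemma same_oriented_curve_cong:
  assumes "\<And>s. 0 \<le> s \<Longrightarrow> s < 1 \<Longrightarrow> \<gamma> s = \<delta> s"
  shows "same_oriented_curve \<gamma> \<delta>"
  unfolding same_oriented_curve_def
  by (rule exI[of _ "\<lambda>x. x"]) (auto simp: strict_mono_def frac_lt_1 assms)

lemma S3_homeomorphism_compose:
  "\<exists>g. homeomorphism S3 S3 h g \<Longrightarrow> \<exists>g. homeomorphism S3 S3 k g \<Longrightarrow> \<exists>g. homeomorphism S3 S3 (k \<circ> h) g"
  by (blast intro: homeomorphism_compose)

lemma isotopic_to_id_compose:
  assumes "isotopic_to_id h" "isotopic_to_id k"
  shows "isotopic_to_id (k \<circ> h)"
proof -
  have c: "continuous_map (top_of_set S3) (top_of_set S3) h"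
    and p: "\<exists>g. homeomorphism S3 S3 h g"
    using homotopic_with_imp_continuous_maps[OF assms(1)[unfolded isotopic_to_id_def]]
      homotopic_with_imp_property[OF assms(1)[unfolded isotopic_to_id_def]] by simp_all
  have "homotopic_with_canon (\<lambda>f. \<exists>g. homeomorphism S3 S3 f g) S3 S3 (id \<circ> h) (k \<circ> h)"
    using assms(2) unfolding isotopic_to_id_def
    by (rule homotopic_with_compose_continuous_map_right[OF _ c])
       (rule S3_homeomorphism_compose[OF p])
  then show ?thesis
    using homotopic_with_trans[OF assms(1)[unfolded isotopic_to_id_def]]
    unfolding isotopic_to_id_def by simp
qed

lemma isotopic_to_id_inverse:
  assumes "isotopic_to_id h"
  shows "\<exists>g. isotopic_to_id g \<and> (\<forall>x\<in>S3. g (h x) = x)"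
proof -
  from assms obtain g where g: "homeomorphism S3 S3 h g"
    using homotopic_with_imp_property[OF assms(1)[unfolded isotopic_to_id_def]] by blast
  have c: "continuous_map (top_of_set S3) (top_of_set S3) g"
    using g by (auto simp: homeomorphism_def)
  have g': "\<exists>f. homeomorphism S3 S3 g f" using homeomorphism_symD[OF g] by blast
  have 1: "homotopic_with_canon (\<lambda>f. \<exists>g. homeomorphism S3 S3 f g) S3 S3 (id \<circ> g) (h \<circ> g)"
    using assms unfolding isotopic_to_id_def
    by (rule homotopic_with_compose_continuous_map_right[OF _ c])
       (rule S3_homeomorphism_compose[OF g'])
  have i: "homeomorphism S3 S3 id id" by (simp add: homeomorphism_def)
  have j: "homeomorphism S3 S3 (h \<circ> g) id"
    using g by (auto simp: homeomorphism_def intro!: continuous_on_compose)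
  have 2: "homotopic_with_canon (\<lambda>f. \<exists>g. homeomorphism S3 S3 f g) S3 S3 id (h \<circ> g)"
    by (rule homotopic_with_equal) (use i j g in \<open>auto simp: homeomorphism_def\<close>)
  have "homotopic_with_canon (\<lambda>f. \<exists>g. homeomorphism S3 S3 f g) S3 S3 id g"
    using homotopic_with_trans[OF 2 homotopic_with_symD[OF 1]] by simp
  moreover have "g (h x) = x" if "x \<in> S3" for x using g that by (auto simp: homeomorphism_def)
  ultimately show ?thesis unfolding isotopic_to_id_def by blast
qed

lemma link_isotopic_refl: "link_isotopic L L"
proof -
  have "isotopic_to_id id"
    using homeomorphism_ident[of S3] unfolding isotopic_to_id_def homotopic_with_refl
    by (auto simp: id_def)
  moreover have "bij_betw id L L" by simp
  moreover have "\<forall>\<gamma>\<in>L. same_oriented_curve (id \<circ> \<gamma>) (id \<gamma>)"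
    by (simp add: same_oriented_curve_refl)
  ultimately show ?thesis unfolding link_isotopic_def by blast
qed

lemma link_isotopic_trans:
  assumes "link_isotopic L L'" "link_isotopic L' L''"
  shows "link_isotopic L L''"
proof -
  from assms obtain h f k g where
    1: "isotopic_to_id h" "bij_betw f L L'" "\<forall>\<gamma>\<in>L. same_oriented_curve (h \<circ> \<gamma>) (f \<gamma>)" and
    2: "isotopic_to_id k" "bij_betw g L' L''" "\<forall>\<gamma>\<in>L'. same_oriented_curve (k \<circ> \<gamma>) (g \<gamma>)"
    unfolding link_isotopic_def by blast
  have "same_oriented_curve ((k \<circ> h) \<circ> \<gamma>) ((g \<circ> f) \<gamma>)" if "\<gamma> \<in> L" for \<gamma>
  proof -
    have "f \<gamma> \<in> L'" using that 1(2) by (auto simp: bij_betw_def)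
    then have "same_oriented_curve (k \<circ> f \<gamma>) (g (f \<gamma>))" using 2(3) by blast
    moreover have "same_oriented_curve (k \<circ> (h \<circ> \<gamma>)) (k \<circ> f \<gamma>)"
      using 1(3) that by (blast intro: same_oriented_curve_compose)
    ultimately have "same_oriented_curve (k \<circ> (h \<circ> \<gamma>)) (g (f \<gamma>))"
      by (rule same_oriented_curve_trans[rotated])
    then show ?thesis by (simp add: comp_assoc)
  qed
  then show ?thesis
    unfolding link_isotopic_def
    using isotopic_to_id_compose[OF 1(1) 2(1)] bij_betw_trans[OF 1(2) 2(2)] by blast
qed

lemma link_isotopic_sym:
  assumes "L \<in> oriented_links" "link_isotopic L L'"
  shows "link_isotopic L' L"
proof -
  from assms obtain h f where
    1: "isotopic_to_id h" "bij_betw f L L'" "\<forall>\<gamma>\<in>L. same_oriented_curve (h \<circ> \<gamma>) (f \<gamma>)"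
    unfolding link_isotopic_def by blast
  obtain g where g: "isotopic_to_id g" "\<forall>x\<in>S3. g (h x) = x"
    using isotopic_to_id_inverse[OF 1(1)] by blast
  define f' where "f' = inv_into L f"
  have f': "bij_betw f' L' L" unfolding f'_def by (rule bij_betw_inv_into[OF 1(2)])
  have "same_oriented_curve (g \<circ> \<delta>) (f' \<delta>)" if "\<delta> \<in> L'" for \<delta>
  proof -
    have m: "f' \<delta> \<in> L" "f (f' \<delta>) = \<delta>"
      using bij_betw_apply[OF f' that] bij_betw_inv_into_right[OF 1(2) that]
      by (simp_all add: f'_def)
    have "f' \<delta> s \<in> S3" if "0 \<le> s" "s < 1" for s
    proof -
      have "path_image (f' \<delta>) \<subseteq> S3" using m(1) assms(1) by (simp add: oriented_links_def)
      then show ?thesis using that by (auto simp: path_image_def)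
    qed
    then have "same_oriented_curve (g \<circ> (h \<circ> f' \<delta>)) (f' \<delta>)"
      by (intro same_oriented_curve_cong) (simp add: g)
    moreover have "same_oriented_curve (h \<circ> f' \<delta>) \<delta>"
      using bspec[OF 1(3) m(1)] m(2) by simp
    then have "same_oriented_curve (g \<circ> \<delta>) (g \<circ> (h \<circ> f' \<delta>))"
      by (rule same_oriented_curve_compose[OF same_oriented_curve_sym])
    ultimately show ?thesis by (rule same_oriented_curve_trans[rotated])
  qed
  with g(1) f' show ?thesis unfolding link_isotopic_def by blast
qed

lemma equiv_link_isotopic:
  "equiv oriented_links
     {(L, L'). L \<in> oriented_links \<and> L' \<in> oriented_links \<and> link_isotopic L L'}"
proof (rule equivI)
  let ?R = "{(L, L'). L \<in> oriented_links \<and> L' \<in> oriented_links \<and> link_isotopic L L'}"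
  show "?R \<subseteq> oriented_links \<times> oriented_links" by blast
  show "refl_on oriented_links ?R" by (auto simp: refl_on_def link_isotopic_refl)
  show "sym ?R" using link_isotopic_sym unfolding sym_def by blast
  show "trans ?R" using link_isotopic_trans unfolding trans_def by blast
qed

text \<open>
  Ambient isotopy is taken in the topological category. A class containing a closed braid consists
  of tame links; wild links form further classes, which have no braid representatives.
\<close>

definition link_types :: "closed_curve set set set" where
  "link_types = oriented_links // {(L, L'). L \<in> oriented_links \<and> L' \<in> oriented_links \<and> link_isotopic L L'}"


section \<open>Closed braids\<close>

text \<open>
  Strand \<open>p\<close> starts at the point \<open>p\<close> of the complex plane. The generator \<open>\<sigma>\<^sub>i\<close> rotates the points
  \<open>i\<close> and \<open>i + 1\<close> by a counterclockwise half turn around their midpoint, its inverse by a clockwise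
  one.
\<close>

definition letter_strand :: "letter \<Rightarrow> nat \<Rightarrow> real \<Rightarrow> complex" where
  "letter_strand l p = (\<lambda>t.
     let i = fst l; c = of_nat i + 1 / 2; e = cis (if snd l then pi * t else - (pi * t))
     in if p = i then c - e / 2 else if p = i + 1 then c + e / 2 else of_nat p)"

primrec word_perm :: "letter list \<Rightarrow> nat \<Rightarrow> nat" where
  "word_perm [] p = p"
| "word_perm (l # w) p = word_perm w (Transposition.transpose (fst l) (fst l + 1) p)"

primrec strand :: "letter list \<Rightarrow> nat \<Rightarrow> real \<Rightarrow> complex" where
  "strand [] p = (\<lambda>t. of_nat p)"
| "strand (l # w) p =
     letter_strand l p +++ strand w (Transposition.transpose (fst l) (fst l + 1) p)"

text \<open>
  The map \<open>(z, t) \<mapsto> (z, exp (2\<pi>it)) / \<parallel>(z, exp (2\<pi>it))\<parallel>\<close> induces a homeomorphism from the open solid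
  torus \<open>\<complex> \<times> \<real>/\<int>\<close> onto the complement of the braid axis \<open>{(z, 0)}\<close> in the 3-sphere. With the
  orientation of the 3-sphere as boundary of the unit ball of \<open>\<complex>\<^sup>2\<close>, a counterclockwise half turn
  becomes a positive crossing.
\<close>

definition strand_in_S3 :: "letter list \<Rightarrow> nat \<Rightarrow> real \<Rightarrow> complex \<times> complex" where
  "strand_in_S3 w p = (\<lambda>t. sgn (strand w p t, cis (2 * pi * t)))"

text \<open>Follow the closed braid from strand \<open>p\<close> for \<open>k + 1\<close> turns around the axis.\<close>

primrec turns :: "letter list \<Rightarrow> nat \<Rightarrow> nat \<Rightarrow> closed_curve" where
  "turns w 0 p = strand_in_S3 w p"
| "turns w (Suc k) p = strand_in_S3 w p +++ turns w k (word_perm w p)"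

text \<open>There is one component for each cycle of the permutation, here started at its least element.\<close>

definition closed_braid :: "nat \<Rightarrow> letter list \<Rightarrow> closed_curve set" where
  "closed_braid m w =
     {turns w (card (orbit (word_perm w) p) - 1) p | p.
        p \<in> {1..m} \<and> (\<forall>q \<in> orbit (word_perm w) p. p \<le> q)}"

lemma cis_half_neq:
  fixes c :: complex assumes "c = of_nat i + 1/2" "q \<noteq> i" "q \<noteq> i + 1" "norm e = 1"
  shows "c + e/2 \<noteq> of_nat q"
proof
  assume "c + e/2 = of_nat q"
  then have "e / 2 = of_real (real q - real i - 1/2)" using assms by (simp add: algebra_simps)
  then have "norm e / 2 = \<bar>real q - real i - 1/2\<bar>"
    by (metis norm_divide norm_of_real norm_numeral)
  then have "real q = real i \<or> real q = real (i + 1)" using assms(4) by (simp add: abs_if split: if_splits)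
  then show False using assms(2,3) by (simp only: of_nat_eq_iff) simp
qed

lemma letter_strand_neq:
  assumes "p \<noteq> q" shows "letter_strand l p t \<noteq> letter_strand l q t"
proof -
  define e where "e = cis (if snd l then pi * t else - (pi * t))"
  define c :: complex where "c = of_nat (fst l) + 1/2"
  have e: "norm e = 1" "norm (-e) = 1" "e \<noteq> 0" by (auto simp: e_def)
  have n: "c + e/2 \<noteq> of_nat r" "c - e/2 \<noteq> of_nat r" if "r \<noteq> fst l" "r \<noteq> fst l + 1" for r
    using cis_half_neq[OF c_def that e(1)] cis_half_neq[OF c_def that e(2)] by simp_all
  have L: "letter_strand l r t = (if r = fst l then c - e / 2 else if r = fst l + 1 then c + e / 2 else of_nat r)" for r
    by (simp add: letter_strand_def Let_def e_def c_def)
  have x: "c - e/2 \<noteq> c + e/2" using e(3) by (simp add: field_simps)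
  have s: "of_nat r \<noteq> c + e/2" "of_nat r \<noteq> c - e/2" if "r \<noteq> fst l" "r \<noteq> fst l + 1" for r
    using n[OF that] by metis+
  show ?thesis unfolding L using assms x x[symmetric] n s by (simp split: if_splits)
qed

lemma letter_strand_path: "path (letter_strand l p)"
proof -
  have "continuous_on {0..1} (\<lambda>t. cis (if snd l then pi * t else - (pi * t)))"
    by (cases "snd l") (auto intro!: continuous_intros)
  then show ?thesis
    unfolding path_def letter_strand_def Let_def
    by (cases "p = fst l"; cases "p = fst l + 1") (auto intro!: continuous_on_add continuous_on_diff continuous_on_divide continuous_on_const)
qed

lemma letter_strand_0: "letter_strand l p 0 = of_nat p"
  by (auto simp: letter_strand_def Let_def field_simps)

lemma letter_strand_1: "letter_strand l p 1 = of_nat (Transposition.transpose (fst l) (fst l + 1) p)"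
proof -
  have "cis (- pi) = -1" by (simp add: complex_eq_iff)
  then show ?thesis
  by (auto simp: letter_strand_def Let_def field_simps Transposition.transpose_def)
qed

lemma strand_0: "strand w p 0 = of_nat p"
  by (cases w) (auto simp: joinpaths_def letter_strand_0)

lemma strand_1: "strand w p 1 = of_nat (word_perm w p)"
  by (induction w arbitrary: p) (auto simp: joinpaths_def)

lemma strand_path: "path (strand w p)"
proof (induction w arbitrary: p)
  case Nil then show ?case by (simp add: path_def)
next
  case (Cons l w)
  then show ?case
    by (auto intro!: path_join_imp letter_strand_path simp: pathfinish_def pathstart_def strand_0 letter_strand_1)
qed

lemma strand_neq: "p \<noteq> q \<Longrightarrow> strand w p t \<noteq> strand w q t"
proof (induction w arbitrary: p q t)
  case (Cons l w)
  have "Transposition.transpose (fst l) (fst l + 1) p \<noteq> Transposition.transpose (fst l) (fst l + 1) q"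
    using Cons.prems by (auto simp: Transposition.transpose_def split: if_splits)
  from Cons.IH[OF this] letter_strand_neq[OF Cons.prems]
  show ?case by (auto simp: joinpaths_def)
qed simp

lemma word_perm_permutes: "w \<in> artin_words m \<Longrightarrow> word_perm w permutes {1..m}"
proof (induction w)
  case Nil
  have "word_perm [] = id" by (auto simp: fun_eq_iff)
  then show ?case by (simp only: permutes_id)
next
  case (Cons l w)
  have "word_perm (l # w) = word_perm w \<circ> Transposition.transpose (fst l) (fst l + 1)"
    by (auto simp: fun_eq_iff)
  moreover have "Transposition.transpose (fst l) (fst l + 1) permutes {1..m}"
    using Cons.prems by (intro permutes_swap_id) (auto simp: artin_words_def)
  moreover have "word_perm w permutes {1..m}"
    using Cons by (simp add: artin_words_def)
  ultimately show ?case by (simp only: permutes_compose)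
qed

lemma strand_in_S3_S3: "strand_in_S3 w p t \<in> S3"
  by (auto simp: strand_in_S3_def S3_def norm_sgn prod_eq_iff)

lemma strand_in_S3_path: "path (strand_in_S3 w p)"
  unfolding path_def strand_in_S3_def sgn_div_norm
  using strand_path[of w p, unfolded path_def]
  by (auto intro!: continuous_intros simp: prod_eq_iff)

lemma sgn_pair_eq:
  assumes "sgn (a, u) = sgn (b, v)" "norm (u::complex) = 1" "norm (v::complex) = 1"
  shows "(a::complex) = b \<and> u = v"
proof -
  let ?A = "norm (a, u)" let ?B = "norm (b, v)"
  have nz: "?A \<noteq> 0" "?B \<noteq> 0" using assms by (auto simp: prod_eq_iff)
  have e: "a /\<^sub>R norm (a, u) = b /\<^sub>R norm (b, v)" "u /\<^sub>R norm (a, u) = v /\<^sub>R norm (b, v)"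
    using assms(1) by (simp_all add: sgn_div_norm)
  from e(2) have "norm (u /\<^sub>R norm (a, u)) = norm (v /\<^sub>R norm (b, v))" by simp
  then have "?A = ?B" using assms(2,3) nz by (simp add: )
  with e nz show ?thesis by simp
qed

lemma strand_in_S3_eq:
  assumes "strand_in_S3 w p t = strand_in_S3 w q s" "t \<in> {0..1}" "s \<in> {0..1}"
  shows "t = s \<and> p = q \<or> t = 0 \<and> s = 1 \<and> p = word_perm w q \<or> t = 1 \<and> s = 0 \<and> q = word_perm w p"
proof -
  have 1: "strand w p t = strand w q s" "cis (2 * pi * t) = cis (2 * pi * s)"
    using sgn_pair_eq[OF assms(1)[unfolded strand_in_S3_def]] by auto
  then have "sin (2 * pi * t) = sin (2 * pi * s) \<and> cos (2 * pi * t) = cos (2 * pi * s)"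
    by (simp add: complex_eq_iff)
  then obtain n :: int where "2 * pi * t = 2 * pi * s + 2 * pi * n" by (auto simp: sin_cos_eq_iff)
  then have "2 * pi * (t - s - n) = 0" by (simp add: algebra_simps)
  then have n: "t - s = n" by simp
  then have "-1 \<le> n" "n \<le> 1" using assms(2,3) by auto
  then consider "n = -1" | "n = 0" | "n = 1" by linarith
  then show ?thesis
  proof cases
    case 1 then have "t = 0" "s = 1" using n assms by auto
    then show ?thesis using \<open>strand w p t = _\<close> by (simp add: strand_0 strand_1)
  next
    case 2 then have "t = s" using n by auto
    then show ?thesis using \<open>strand w p t = _\<close> strand_neq by metis
  next
    case 3 then have "t = 1" "s = 0" using n assms by auto
    then show ?thesis using \<open>strand w p t = _\<close> by (simp add: strand_0 strand_1)
  qed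
qed

lemma strand_in_S3_ends:
  "strand_in_S3 w p 1 = strand_in_S3 w (word_perm w p) 0"
  by (simp add: strand_in_S3_def strand_0 strand_1)

lemma turns_0: "turns w k p 0 = strand_in_S3 w p 0"
  by (cases k) (auto simp: joinpaths_def)

lemma turns_1: "turns w k p 1 = strand_in_S3 w ((word_perm w ^^ Suc k) p) 0"
proof (induction k arbitrary: p)
  case (Suc k)
  have "turns w (Suc k) p 1 = turns w k (word_perm w p) 1" by (simp add: joinpaths_def)
  then show ?case unfolding Suc by (simp only: funpow_Suc_right comp_apply)
qed (simp add: strand_in_S3_ends)

lemma turns_image:
  "path_image (turns w k p) = (\<Union>i\<le>k. path_image (strand_in_S3 w ((word_perm w ^^ i) p)))"
proof (induction k arbitrary: p)
  case (Suc k)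
  have "path_image (turns w (Suc k) p) = path_image (strand_in_S3 w p) \<union> path_image (turns w k (word_perm w p))"
    by (simp add: path_image_join pathfinish_def pathstart_def turns_0 strand_in_S3_ends)
  also have "\<dots> = path_image (strand_in_S3 w p) \<union>
     (\<Union>i\<le>k. path_image (strand_in_S3 w ((word_perm w ^^ Suc i) p)))"
    unfolding Suc by (simp only: funpow_Suc_right comp_apply)
  also have "\<dots> = (\<Union>i\<le>Suc k. path_image (strand_in_S3 w ((word_perm w ^^ i) p)))"
    by (simp only: atMost_Suc_eq_insert_0 image_insert image_image Union_insert image_Union UN_insert)
       simp
  finally show ?case .
qed simp

lemma strand_arc:
  assumes "word_perm w p \<noteq> p" shows "arc (strand_in_S3 w p)"
  unfolding arc_def
proof (intro conjI strand_in_S3_path inj_onI)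
  fix t s :: real assume "t \<in> {0..1}" "s \<in> {0..1}" "strand_in_S3 w p t = strand_in_S3 w p s"
  with strand_in_S3_eq[of w p t p s] assms show "t = s" by auto
qed

lemma strand_turns_inter:
  assumes "\<And>i. 1 \<le> i \<Longrightarrow> i \<le> Suc k \<Longrightarrow> (word_perm w ^^ i) p \<noteq> p"
    and inj: "inj (word_perm w)"
  shows "path_image (strand_in_S3 w p) \<inter> path_image (turns w k (word_perm w p))
    \<subseteq> (if (word_perm w ^^ (k+2)) p = p then {strand_in_S3 w p 0} else {}) \<union> {strand_in_S3 w (word_perm w p) 0}"
proof
  fix x assume "x \<in> path_image (strand_in_S3 w p) \<inter> path_image (turns w k (word_perm w p))"
  then have "x \<in> strand_in_S3 w p ` {0..1}" and 
    "x \<in> (\<Union>i\<le>k. strand_in_S3 w ((word_perm w ^^ i) (word_perm w p)) ` {0..1})"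
    unfolding turns_image by (simp_all add: path_image_def)
  then obtain t i s where x: "x = strand_in_S3 w p t" "t \<in> {0..1}" "i \<le> k" "s \<in> {0..1}"
     "x = strand_in_S3 w ((word_perm w ^^ i) (word_perm w p)) s"
    by (elim imageE UN_E) (simp only: atMost_iff)
  have x5: "x = strand_in_S3 w ((word_perm w ^^ Suc i) p) s" using x(5) by (simp only: funpow_Suc_right comp_apply)
  let ?q = "(word_perm w ^^ Suc i) p"
  have pq: "?q \<noteq> p" using assms(1)[of "Suc i"] x(3) by (simp del: funpow.simps)
  from strand_in_S3_eq[of w p t ?q s] x x5 pq
  consider "t = 0" "s = 1" "p = word_perm w ?q" | "t = 1" "s = 0" "?q = word_perm w p" by metis
  then show "x \<in> (if (word_perm w ^^ (k+2)) p = p then {strand_in_S3 w p 0} else {}) \<union> {strand_in_S3 w (word_perm w p) 0}"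
  proof cases
    case 1
    then have q: "(word_perm w ^^ (i+2)) p = p" by simp
    have "i = k" using assms(1)[of "i+2"] q x(3) by (cases "i = k") auto
    then show ?thesis using q x(1) 1 by simp
  next
    case 2
    then show ?thesis using x(1) strand_in_S3_ends by simp
  qed
qed

lemma turns_arc:
  assumes "inj (word_perm w)"
  shows "inj_on (\<lambda>i. (word_perm w ^^ i) p) {..Suc k} \<Longrightarrow> arc (turns w k p)"
proof (induction k arbitrary: p)
  case 0
  have "word_perm w p \<noteq> p" using inj_onD[OF 0, of 0 1] by auto
  then show ?case using strand_arc by simp
next
  case (Suc k)
  have ne: "(word_perm w ^^ i) p \<noteq> p" if "1 \<le> i" "i \<le> k+2" for i
    using inj_onD[OF Suc.prems, of i 0] that by auto
  have "inj_on (\<lambda>i. (word_perm w ^^ i) (word_perm w p)) {..Suc k}"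
  proof (rule inj_onI)
    fix i j assume "i \<in> {..Suc k}" "j \<in> {..Suc k}" "(word_perm w ^^ i) (word_perm w p) = (word_perm w ^^ j) (word_perm w p)"
    then have "(word_perm w ^^ Suc i) p = (word_perm w ^^ Suc j) p" "Suc i \<in> {..Suc (Suc k)}" "Suc j \<in> {..Suc (Suc k)}"
      by (simp_all only: funpow_Suc_right comp_apply) auto
    then show "i = j" using inj_onD[OF Suc.prems] by blast
  qed
  then have a2: "arc (turns w k (word_perm w p))" by (rule Suc.IH)
  have a1: "arc (strand_in_S3 w p)" using ne[of 1] by (intro strand_arc) simp
  have "path_image (strand_in_S3 w p) \<inter> path_image (turns w k (word_perm w p)) \<subseteq> {strand_in_S3 w (word_perm w p) 0}"
    using strand_turns_inter[of k w p] ne ne[of "k+2"] assms by (auto split: if_splits simp del: funpow.simps)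
  then show ?case using a1 a2
    by (auto intro!: arc_join simp: pathfinish_def pathstart_def turns_0 strand_in_S3_ends)
qed

lemma turns_simple:
  assumes inj: "inj (word_perm w)" and io: "inj_on (\<lambda>i. (word_perm w ^^ i) p) {..k}"
    and per: "(word_perm w ^^ Suc k) p = p"
  shows "simple_path (turns w k p)"
proof (cases k)
  case 0
  then have f: "word_perm w p = p" using per by simp
  have "loop_free (strand_in_S3 w p)"
    unfolding loop_free_def using strand_in_S3_eq[of w p _ p] by blast
  then show ?thesis using 0 strand_in_S3_path by (simp add: simple_path_def)
next
  case (Suc k')
  have ne: "(word_perm w ^^ i) p \<noteq> p" if "1 \<le> i" "i \<le> Suc k'" for i
    using inj_onD[OF io, of i 0] that Suc by auto
  have "inj_on (\<lambda>i. (word_perm w ^^ i) (word_perm w p)) {..Suc k'}"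
  proof (rule inj_onI)
    fix i j assume ij: "i \<in> {..Suc k'}" "j \<in> {..Suc k'}" "(word_perm w ^^ i) (word_perm w p) = (word_perm w ^^ j) (word_perm w p)"
    then have "word_perm w ((word_perm w ^^ i) p) = word_perm w ((word_perm w ^^ j) p)"
      by (simp add: funpow_swap1)
    then have "(word_perm w ^^ i) p = (word_perm w ^^ j) p" using inj by (simp add: inj_eq)
    then show "i = j" using inj_onD[OF io] ij Suc by blast
  qed
  then have a2: "arc (turns w k' (word_perm w p))" by (rule turns_arc[OF inj])
  have a1: "arc (strand_in_S3 w p)" using ne[of 1] by (intro strand_arc) simp
  have "path_image (strand_in_S3 w p) \<inter> path_image (turns w k' (word_perm w p)) \<subseteq> {strand_in_S3 w p 0, strand_in_S3 w (word_perm w p) 0}"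
    using strand_turns_inter[of k' w p] ne inj by (auto split: if_splits simp del: funpow.simps)
  moreover have "turns w k' (word_perm w p) 1 = strand_in_S3 w p 0"
    using per Suc by (simp only: turns_1 funpow_Suc_right comp_apply)
  ultimately show ?thesis using a1 a2 Suc
    by (auto intro!: simple_path_join_loop simp: pathfinish_def pathstart_def turns_0 strand_in_S3_ends)
qed

lemma closed_braid_link:
  assumes w: "w \<in> artin_words m" and m: "m \<ge> 1"
  shows "closed_braid m w \<in> oriented_links"
proof -
  let ?f = "word_perm w"
  have perm: "?f permutes {1..m}" by (rule word_perm_permutes[OF w])
  have inj: "inj ?f" using perm by (rule permutes_inj)
  have pp: "permutation ?f" unfolding permutation_permutes using perm by (intro exI[of _ "{1..m}"]) simp
  have self: "p \<in> orbit ?f p" for p by (rule permutation_self_in_orbit[OF pp])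
  let ?k = "\<lambda>p. card (orbit ?f p) - 1"
  have card: "inj_on (\<lambda>i. (?f ^^ i) p) {..?k p} \<and> (?f ^^ Suc (?k p)) p = p" for p
  proof -
    let ?d = "funpow_dist1 ?f p p"
    have "card (orbit ?f p) = ?d"
      using inj_on_funpow_dist1[OF self] by (subst orbit_conv_funpow_dist1[OF self]) (simp add: card_image)
    then have "Suc (?k p) = ?d" by simp
    moreover from this have "{..?k p} = {0..<?d}" by auto
    ultimately show ?thesis
      using inj_on_funpow_dist1[OF self, of p] funpow_dist1_prop[OF self, of p] by simp
  qed
  have simp: "simple_path (turns w (?k p) p)" for p using turns_simple[OF inj] card by blast
  have cl: "turns w (?k p) p 1 = turns w (?k p) p 0" for p
    using card[of p] by (simp only: turns_0 turns_1)
  have im: "path_image (turns w k p) \<subseteq> S3" for k p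
    unfolding turns_image using strand_in_S3_S3 by (auto simp: path_image_def)
  have disj: "p = q" if mn: "\<forall>r\<in>orbit ?f p. p \<le> r" "\<forall>r\<in>orbit ?f q. q \<le> r"
     and ne: "path_image (turns w k p) \<inter> path_image (turns w l q) \<noteq> {}" for p q k l
  proof -
    obtain i j t s where e: "t \<in> {0..1}" "s \<in> {0..1}" "strand_in_S3 w ((?f ^^ i) p) t = strand_in_S3 w ((?f ^^ j) q) s"
    proof -
      obtain x where "x \<in> path_image (turns w k p)" "x \<in> path_image (turns w l q)" using ne by blast
      then obtain i j where "x \<in> path_image (strand_in_S3 w ((?f ^^ i) p))"
        "x \<in> path_image (strand_in_S3 w ((?f ^^ j) q))"
        unfolding turns_image by blast
      then obtain t s where "t \<in> {0..1}" "s \<in> {0..1}" "x = strand_in_S3 w ((?f ^^ i) p) t"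
        "x = strand_in_S3 w ((?f ^^ j) q) s"
        unfolding path_image_def by blast
      then show thesis using that[of t s i j] by simp
    qed
    let ?p = "(?f ^^ i) p" let ?q = "(?f ^^ j) q"
    have "?p = ?q \<or> ?p = ?f ?q \<or> ?q = ?f ?p" using strand_in_S3_eq[OF e(3) e(1,2)] by blast
    then have "orbit ?f ?p = orbit ?f ?q"
      using permutation_orbit_step[OF pp, of ?p] permutation_orbit_step[OF pp, of ?q] by auto
    moreover have "orbit ?f ((?f ^^ i) p) = orbit ?f p" for i p
      by (induction i) (auto simp: permutation_orbit_step[OF pp])
    ultimately have "orbit ?f p = orbit ?f q" by simp
    then have "p \<in> orbit ?f q" "q \<in> orbit ?f p" using self[of p] self[of q] by simp_all
    then show ?thesis using mn by (intro antisym) simp_all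
  qed
  have "closed_braid m w \<subseteq> (\<lambda>p. turns w (?k p) p) ` {1..m}" unfolding closed_braid_def by blast
  then have "finite (closed_braid m w)" by (rule finite_subset) simp
  moreover have "closed_braid m w \<noteq> {}"
  proof -
    have "orbit ?f 1 \<subseteq> {1..m}" using perm m by (intro permutes_orbit_subset) auto
    then have "turns w (?k 1) 1 \<in> closed_braid m w" unfolding closed_braid_def using m by (intro CollectI exI[of _ 1]) auto
    then show ?thesis by blast
  qed
  moreover have "simple_path \<gamma> \<and> pathfinish \<gamma> = pathstart \<gamma> \<and> path_image \<gamma> \<subseteq> S3" if \<gamma>: "\<gamma> \<in> closed_braid m w" for \<gamma>
  proof -
    obtain p where "\<gamma> = turns w (?k p) p" using \<gamma> unfolding closed_braid_def by blast
    then show ?thesis using simp[of p] cl[of p] im[of "?k p" p]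
      by (simp add: pathfinish_def pathstart_def)
  qed
  moreover have "path_image \<gamma> \<inter> path_image \<delta> = {}" if \<gamma>: "\<gamma> \<in> closed_braid m w" and \<delta>: "\<delta> \<in> closed_braid m w" and "\<gamma> \<noteq> \<delta>" for \<gamma> \<delta>
  proof -
    obtain p q where "\<gamma> = turns w (?k p) p" "\<forall>r\<in>orbit ?f p. p \<le> r" "\<delta> = turns w (?k q) q" "\<forall>r\<in>orbit ?f q. q \<le> r"
      using \<gamma> \<delta> unfolding closed_braid_def by blast
    then show ?thesis using disj[of p q] \<open>\<gamma> \<noteq> \<delta>\<close> by blast
  qed
  ultimately show ?thesis unfolding oriented_links_def by blast
qed

text \<open>
  A braid is an equivalence class of Artin words. Closures of equivalent words are isotopic, so the
  choice of \<open>w\<close> is immaterial.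
\<close>

definition braid_representative :: "nat \<Rightarrow> letter list set \<Rightarrow> closed_curve set set \<Rightarrow> bool" where
  "braid_representative m \<beta> K \<longleftrightarrow>
     m \<ge> 1 \<and> \<beta> \<in> carrier (braid_group m) \<and> (\<exists>w \<in> \<beta>. closed_braid m w \<in> K)"

definition nb_link :: "closed_curve set set \<Rightarrow> nat" where
  "nb_link K = (LEAST k. \<exists>m \<beta>. braid_representative m \<beta> K \<and> nb_braid m \<beta> = k)"

end

theory Submission
  imports Defs
begin

text \<open>
  The letters are the band generators only, not all conjugates of the Artin generators, so
  \<open>nb\<close> is not invariant under conjugation. Take the pure 3-braid
  \<open>\<beta>\<^sub>n = \<sigma>\<^sub>2\<^bsup>-n\<^esup> \<sigma>\<^sub>1\<^sup>2 \<sigma>\<^sub>2\<^bsup>n\<^esup>\<close>. Its closure \<open>K\<^sub>n\<close> is also the closure of the positive braid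
  \<open>\<sigma>\<^sub>1\<^sup>2\<close>, so \<open>nb(K\<^sub>n) = 0\<close>, and it has three components, so no braid on fewer than three strands
  represents it. Map \<open>B\<^sub>3\<close> to \<open>\<langle>s, d | s\<^sup>2 = d\<^sup>3 = 1\<rangle>\<close> by \<open>\<sigma>\<^sub>1 \<mapsto> s d\<^bsup>-1\<^esup>\<close> and
  \<open>\<sigma>\<^sub>2 \<mapsto> d\<^bsup>-1\<^esup> s\<close>. Then \<open>a\<^sub>1\<^sub>3 \<mapsto> d s d\<close>, so the number of letters \<open>s\<close> in the normal form is at
  most the number of bands. For \<open>\<beta>\<^sub>n\<close> it is \<open>2n + 2\<close>, while the exponent sum is 2; hence at least \<open>n\<close>
  bands are negative.
\<close>

section \<open>Band words and Artin words\<close>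

lemma concat_artin_words [simp]:
  "(\<And>u. u \<in> set us \<Longrightarrow> u \<in> artin_words m) \<Longrightarrow> concat us \<in> artin_words m"
  by (induction us) auto

lemma braid_prod_classes:
  assumes "\<And>u. u \<in> set us \<Longrightarrow> u \<in> artin_words m"
  shows "braid_prod m (map (\<lambda>u. braid_rel m `` {u}) us) = braid_rel m `` {concat us}"
proof -
  show ?thesis
    using assms
    by (induction us) (auto simp: braid_prod_def braid_one braid_mult_class)
qed

definition inverse_word :: "letter list \<Rightarrow> letter list" where
  "inverse_word w = rev (map (\<lambda>(i, s). (i, \<not> s)) w)"

lemma inverse_word_simps [simp]:
  "inverse_word [] = []"
  "inverse_word ((i, s) # w) = inverse_word w @ [(i, \<not> s)]"
  by (simp_all add: inverse_word_def)

lemma inverse_word_artin [simp]: "w \<in> artin_words m \<Longrightarrow> inverse_word w \<in> artin_words m"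
  by (force simp: inverse_word_def artin_words_def)

lemma braid_eq_inverse_word: "w \<in> artin_words m \<Longrightarrow> braid_eq m (w @ inverse_word w) []"
proof (induction w)
  case Nil
  then show ?case by (simp add: braid_eq.refl)
next
  case (Cons l w)
  obtain i s where l: "l = (i, s)" by (cases l)
  have i: "1 \<le> i" "i < m" and w: "w \<in> artin_words m"
    using Cons.prems l by (auto simp: artin_words_def)
  have li: "[(i, b)] \<in> artin_words m" for b using i by (simp add: artin_words_def)
  have "braid_eq m ([(i, s)] @ (w @ inverse_word w) @ [(i, \<not> s)]) ([(i, s)] @ [] @ [(i, \<not> s)])"
    by (intro braid_eq.append braid_eq.refl li Cons.IH w)
  then show ?case using braid_eq.cancel[OF i, of s] by (auto simp: l intro: braid_eq.trans)
qed

lemma braid_inv_class: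
  assumes "w \<in> artin_words m"
  shows "inv\<^bsub>braid_group m\<^esub> (braid_rel m `` {w}) = braid_rel m `` {inverse_word w}"
proof (rule group.inv_equality[OF group_braid_group])
  have "braid_rel m `` {w} \<otimes>\<^bsub>braid_group m\<^esub> braid_rel m `` {inverse_word w} = \<one>\<^bsub>braid_group m\<^esub>"
    using assms
    by (simp add: braid_mult_class braid_one braid_class_eq_iff braid_eq_inverse_word)
  then show "braid_rel m `` {inverse_word w} \<otimes>\<^bsub>braid_group m\<^esub> braid_rel m `` {w} = \<one>\<^bsub>braid_group m\<^esub>"
    by (rule group.inv_comm[OF group_braid_group]) (simp_all add: braid_class_carrier assms)
qed (simp_all add: braid_class_carrier assms)

definition band_artin :: "nat \<Rightarrow> nat \<Rightarrow> letter list" where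
  "band_artin i j =
     (let c = map (\<lambda>k. (k, True)) (rev [i + 1..<j]) in c @ [(i, True)] @ inverse_word c)"

fun band_letter_artin :: "band_letter \<Rightarrow> letter list" where
  "band_letter_artin (i, j, s) = (if s then band_artin i j else inverse_word (band_artin i j))"

lemma band_class:
  assumes "1 \<le> i" "i < j" "j \<le> m"
  shows "band_artin i j \<in> artin_words m" "band m i j = braid_rel m `` {band_artin i j}"
proof -
  let ?c = "map (\<lambda>k. (k, True)) (rev [i + 1..<j])"
  have c: "?c \<in> artin_words m" and i: "[(i, True)] \<in> artin_words m"
    using assms by (auto simp: artin_words_def)
  have "braid_prod m (map (artin_gen m) (rev [i + 1..<j])) =
      braid_prod m (map (\<lambda>u. braid_rel m `` {u}) (map (\<lambda>k. [(k, True)]) (rev [i + 1..<j])))"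
    by (simp add: artin_gen_def[abs_def] o_def)
  also have "\<dots> = braid_rel m `` {concat (map (\<lambda>k. [(k, True)]) (rev [i + 1..<j]))}"
    by (rule braid_prod_classes) (use assms in \<open>auto simp: artin_words_def\<close>)
  also have "concat (map (\<lambda>k. [(k, True)]) (rev [i + 1..<j])) = ?c" by (simp only: concat_map_singleton)
  finally have p: "braid_prod m (map (artin_gen m) (rev [i + 1..<j])) = braid_rel m `` {?c}" .
  show "band_artin i j \<in> artin_words m"
    unfolding band_artin_def Let_def artin_words_append using c i inverse_word_artin by blast
  show "band m i j = braid_rel m `` {band_artin i j}"
    unfolding band_def Let_def p band_artin_def artin_gen_def
    using c i by (simp only: braid_inv_class braid_mult_class artin_words_append inverse_word_artin append_assoc simp_thms)
qed

lemma band_letter_artin_words: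
  "W \<in> band_words m \<Longrightarrow> b \<in> set W \<Longrightarrow> band_letter_artin b \<in> artin_words m"
  by (auto simp: band_words_def band_class)

lemma band_value_class:
  assumes "W \<in> band_words m"
  shows "band_value m W = braid_rel m `` {concat (map band_letter_artin W)}"
proof -
  have "(\<lambda>(i, j, s). if s then band m i j else inv\<^bsub>braid_group m\<^esub> (band m i j)) b =
      braid_rel m `` {band_letter_artin b}" if "b \<in> set W" for b
  proof (cases b)
    case (fields i j s)
    then have "1 \<le> i" "i < j" "j \<le> m" using that assms by (auto simp: band_words_def)
    from band_class[OF this] show ?thesis by (simp add: fields braid_inv_class)
  qed
  then have "band_value m W = braid_prod m (map (\<lambda>u. braid_rel m `` {u}) (map band_letter_artin W))"
    unfolding band_value_def map_map o_def by (intro arg_cong[of _ _ "braid_prod m"] map_cong) auto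
  also have "\<dots> = braid_rel m `` {concat (map band_letter_artin W)}"
    by (rule braid_prod_classes) (use band_letter_artin_words[OF assms] in auto)
  finally show ?thesis .
qed

lemma nb_braid_eqI:
  assumes "W \<in> band_words m" "band_value m W = \<beta>"
    and "\<And>V. V \<in> band_words m \<Longrightarrow> band_value m V = \<beta> \<Longrightarrow> nb_word W \<le> nb_word V"
  shows "nb_braid m \<beta> = nb_word W"
  unfolding nb_braid_def by (rule Least_equality) (use assms in blast)+

section \<open>Exponent sum\<close>

definition exponent_sum :: "letter list \<Rightarrow> int" where
  "exponent_sum w = (\<Sum>l\<leftarrow>w. if snd l then 1 else -1)"

lemma exponent_sum_append [simp]: "exponent_sum (u @ v) = exponent_sum u + exponent_sum v"
  by (simp add: exponent_sum_def)

lemma braid_eq_exponent_sum: "braid_eq m u v \<Longrightarrow> exponent_sum u = exponent_sum v"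
  by (induction rule: braid_eq.induct) (auto simp: exponent_sum_def)

lemma exponent_sum_inverse [simp]: "exponent_sum (inverse_word w) = - exponent_sum w"
  by (induction w) (auto simp: exponent_sum_def)

text \<open>A band is a conjugate of a single generator, so a letter contributes 1 or -1. The sum is
  the number of positive bands minus the number of negative ones, while the length is their
  total.\<close>

lemma exponent_sum_bands:
  "exponent_sum (concat (map band_letter_artin W)) = int (length W) - 2 * int (nb_word W)"
proof -
  have "exponent_sum (band_artin i j) = 1" for i j
    by (simp only: band_artin_def Let_def exponent_sum_append exponent_sum_inverse)
      (simp add: exponent_sum_def)
  then show ?thesis by (induction W) (auto simp: nb_word_def exponent_sum_def[of "[]"])
qed

section \<open>The modular group as a quotient of the braid group on three strands\<close>

text \<open>
  The list \<open>[e\<^sub>0, \<dots>, e\<^sub>k]\<close> encodes the element \<open>d\<^bsup>e\<^sub>0\<^esup> s d\<^bsup>e\<^sub>1\<^esup> s \<dots> s d\<^bsup>e\<^sub>k\<^esup>\<close> of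
  \<open>\<langle>s, d | s\<^sup>2 = d\<^sup>3 = 1\<rangle>\<close>, which is in normal form if all exponents but the first and the last are
  non-zero. The functions below are left multiplication by \<open>d\<close> and \<open>s\<close>.
\<close>

fun normal_tail :: "nat list \<Rightarrow> bool" where
  "normal_tail [] \<longleftrightarrow> True"
| "normal_tail (x # xs) \<longleftrightarrow> x < 3 \<and> (xs \<noteq> [] \<longrightarrow> 0 < x) \<and> normal_tail xs"

definition normal_forms :: "nat list set" where
  "normal_forms = {x # xs | x xs. x < 3 \<and> normal_tail xs}"

fun mult_d :: "nat list \<Rightarrow> nat list" where
  "mult_d (x # xs) = (x + 1) mod 3 # xs"
| "mult_d [] = []"

fun mult_s :: "nat list \<Rightarrow> nat list" where
  "mult_s xs = (if hd xs = 0 \<and> tl xs \<noteq> [] then tl xs else 0 # xs)"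

lemma mult_d_normal [simp]: "xs \<in> normal_forms \<Longrightarrow> mult_d xs \<in> normal_forms"
  by (auto simp: normal_forms_def)

lemma mult_s_normal [simp]: "xs \<in> normal_forms \<Longrightarrow> mult_s xs \<in> normal_forms"
  by (auto simp: normal_forms_def neq_Nil_conv)

lemma mult_d3 [simp]: "xs \<in> normal_forms \<Longrightarrow> mult_d (mult_d (mult_d xs)) = xs"
  by (auto simp: normal_forms_def mod_simps)

lemma mult_s2 [simp]: "xs \<in> normal_forms \<Longrightarrow> mult_s (mult_s xs) = xs"
  by (auto simp: normal_forms_def neq_Nil_conv)

lemma length_mult_d [simp]: "length (mult_d xs) = length xs"
  by (cases xs) auto

lemma length_mult_s: "length (mult_s xs) \<le> Suc (length xs)"
  by auto

declare mult_s.simps [simp del]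

text \<open>Here \<open>d^2\<close> plays the role of the inverse of \<open>d\<close>: the letters
  are \<open>s d^2\<close>, its inverse \<open>d s\<close>, then \<open>d^2 s\<close> and its
  inverse \<open>s d\<close>. Every index other than 1 is read as 2, since only three strands
  matter.\<close>

fun letter_act :: "letter \<Rightarrow> nat list \<Rightarrow> nat list" where
  "letter_act (i, b) xs =
     (if i = 1 then if b then mult_s (mult_d (mult_d xs)) else mult_d (mult_s xs)
      else if b then mult_d (mult_d (mult_s xs)) else mult_s (mult_d xs))"

definition word_act :: "letter list \<Rightarrow> nat list \<Rightarrow> nat list" where
  "word_act w xs = foldr letter_act w xs"

lemma word_act_simps [simp]:
  "word_act [] xs = xs"
  "word_act (l # w) xs = letter_act l (word_act w xs)"
  "word_act (u @ v) xs = word_act u (word_act v xs)"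
  by (simp_all add: word_act_def)

lemma letter_act_normal [simp]: "xs \<in> normal_forms \<Longrightarrow> letter_act l xs \<in> normal_forms"
  by (cases l) auto

lemma word_act_normal [simp]: "xs \<in> normal_forms \<Longrightarrow> word_act w xs \<in> normal_forms"
  by (induction w) auto

text \<open>Both sides of the braid relation act as \<open>s\<close>:
  \<open>(s d^2)(d^2 s)(s d^2) = s d^6\<close> and \<open>(d^2 s)(s d^2)(d^2 s) = d^6 s\<close>. On
  three strands no two generators are far apart.\<close>

lemma braid_eq_word_act:
  "braid_eq 3 u v \<Longrightarrow> xs \<in> normal_forms \<Longrightarrow> word_act u xs = word_act v xs"
proof (induction arbitrary: xs rule: braid_eq.induct)
  case (cancel i s)
  then show ?case by (cases s) auto
next
  case (near i)
  then have "i = 1" by simp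
  with near.prems show ?case by simp
qed auto

text \<open>The three bands act as \<open>s d^2\<close>, \<open>d^2 s\<close> and
  \<open>d s d\<close>. Each of them and each inverse contains a single \<open>s\<close>, and
  \<open>mult_d\<close> preserves the length.\<close>

lemma word_act_band:
  assumes "1 \<le> i" "i < j" "j \<le> 3" "xs \<in> normal_forms"
  shows "length (word_act (band_letter_artin (i, j, b)) xs) \<le> Suc (length xs)"
proof -
  consider "i = 1" "j = 2" | "i = 2" "j = 3" | "i = 1" "j = 3" using assms by linarith
  then show ?thesis
    using assms(4) length_mult_s[of "mult_d xs"] length_mult_s[of "mult_d (mult_d xs)"]
      length_mult_s[of xs]
    by cases (cases b; simp add: band_artin_def Let_def upt_rec)+
qed

lemma word_act_bands:
  assumes "W \<in> band_words 3" "xs \<in> normal_forms"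
  shows "length (word_act (concat (map band_letter_artin W)) xs) \<le> length W + length xs"
  using assms(1)
proof (induction W)
  case (Cons l W)
  obtain i j b where l: "l = (i, j, b)" by (cases l)
  have "length (word_act (band_letter_artin l) (word_act (concat (map band_letter_artin W)) xs))
      \<le> Suc (length (word_act (concat (map band_letter_artin W)) xs))"
    unfolding l by (rule word_act_band) (use Cons.prems assms(2) l in \<open>auto simp: band_words_def\<close>)
  also have "\<dots> \<le> Suc (length W + length xs)" using Cons by (simp add: band_words_def)
  finally show ?case by simp
qed simp

text \<open>With p positive and q negative bands the length grows by at most p + q, while the
  exponent sum is p - q. The difference of the two is 2q.\<close>

lemma nb_lower_bound:
  assumes W: "W \<in> band_words 3" "band_value 3 W = braid_rel 3 `` {w}" and w: "w \<in> artin_words 3"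
    and xs: "xs \<in> normal_forms"
  shows "int (length (word_act w xs)) - int (length xs) - exponent_sum w \<le> 2 * int (nb_word W)"
proof -
  let ?v = "concat (map band_letter_artin W)"
  have "?v \<in> artin_words 3" 
    by (rule concat_artin_words) (use band_letter_artin_words[OF W(1)] in auto)
  then have "braid_eq 3 ?v w"
    using W w by (simp add: band_value_class braid_class_eq_iff)
  then have "word_act w xs = word_act ?v xs" "exponent_sum w = exponent_sum ?v"
    using xs by (simp_all add: braid_eq_word_act braid_eq_exponent_sum)
  then show ?thesis using word_act_bands[OF W(1) xs] exponent_sum_bands[of W] by simp
qed

section \<open>The conjugates of the squared generator and their negative bands\<close>

definition twisted_word :: "nat \<Rightarrow> letter list" where
  "twisted_word n = replicate n (2, False) @ [(1, True), (1, True)] @ replicate n (2, True)"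

text \<open>The block of \<open>\<sigma>\<^sub>2\<close> produces n letters \<open>s\<close>, the
  square of \<open>\<sigma>\<^sub>1\<close> two more, and each inverse of
  \<open>\<sigma>\<^sub>2\<close> one more. A list is one longer than its number of letters
  \<open>s\<close>.\<close>

lemma length_word_act_twisted:
  assumes "n \<ge> 1"
  shows "length (word_act (twisted_word n) [0]) = 2 * n + 3"
proof -
  have 1: "word_act (replicate k (2, True)) [0] = replicate k 2 @ [0]" for k
    by (induction k) (auto simp: mult_s.simps neq_Nil_conv hd_append)
  obtain k where n: "n = Suc k" using assms by (cases n) auto
  have 2: "length (word_act (replicate k (2, False)) (0 # Suc y # ys)) = k + length ys + 2" for k y ys
  proof -
    \<comment> \<open>Invariant that excludes cancellation: \<open>d\<close> turns the leading 0
      into 1, so \<open>s\<close> can only be prepended, and the result again starts with 0 and a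
      non-zero exponent.\<close>
    have "\<exists>y' zs. word_act (replicate k (2, False)) (0 # Suc y # ys) = 0 # Suc y' # zs \<and>
        length zs = k + length ys"
    proof (induction k)
      case (Suc k)
      then obtain y' zs where
        "word_act (replicate k (2, False)) (0 # Suc y # ys) = 0 # Suc y' # zs"
        "length zs = k + length ys" by blast
      then show ?case by (simp add: mult_s.simps)
    qed simp
    then show ?thesis by auto
  qed
  have "word_act [(1, True), (1, True)] (replicate n 2 @ [0]) = 0 # Suc 1 # 1 # replicate k 2 @ [0]"
    by (simp add: n mult_s.simps numeral_2_eq_2)
  then show ?thesis unfolding twisted_word_def word_act_simps(3) 1
    by (simp only: 2) (simp add: n)
qed

lemma nb_twisted:
  assumes "n \<ge> 1"
  shows "nb_braid 3 (braid_rel 3 `` {twisted_word n}) = n"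
proof -
  let ?W = "replicate n (2, 3, False) @ [(1, 2, True), (1, 2, True)] @ replicate n (2, 3, True)"
  have [simp]: "band_artin (Suc 0) 2 = [(1, True)]" "band_artin 2 3 = [(2, True)]"
    by (simp_all add: band_artin_def Let_def)
  have cr: "concat (replicate k [x]) = replicate k x" for k and x :: letter
    by (induction k) auto
  have W: "?W \<in> band_words 3" by (auto simp: band_words_def)
  have w: "twisted_word n \<in> artin_words 3" by (auto simp: twisted_word_def artin_words_def)
  have v: "band_value 3 ?W = braid_rel 3 `` {twisted_word n}"
    unfolding band_value_class[OF W] by (simp add: cr twisted_word_def)
  have nb: "nb_word ?W = n" by (simp add: nb_word_def)
  have "exponent_sum (replicate k (2, b)) = (if b then int k else - int k)" for k b
    by (induction k) (auto simp: exponent_sum_def)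
  moreover have "exponent_sum [(1, True), (1, True)] = 2" by (simp add: exponent_sum_def)
  ultimately have e: "exponent_sum (twisted_word n) = 2"
    by (simp only: twisted_word_def exponent_sum_append) simp
  \<comment> \<open>The list \<open>[0]\<close> is the identity. Starting from it, the lower bound
    reads (2n + 3) - 1 - 2 = 2n.\<close>
  have "[0] \<in> normal_forms" by (simp add: normal_forms_def)
  then show ?thesis
    using nb_braid_eqI[OF W v] nb_lower_bound[OF _ _ w] length_word_act_twisted[OF assms] nb e
    by fastforce
qed

section \<open>Isotopies of the 3-sphere\<close>

text \<open>A continuous bijection of the compact sphere onto itself is a homeomorphism, so no
  continuity of the inverses has to be supplied.\<close>

lemma isotopic_to_idI:
  assumes cont: "continuous_on ({0..1} \<times> S3) (\<lambda>(s, x). H s x)"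
    and bij: "\<And>s. s \<in> {0..1} \<Longrightarrow> bij_betw (H s) S3 S3"
    and zero: "\<And>x. x \<in> S3 \<Longrightarrow> H 0 x = x"
  shows "isotopic_to_id (H (1::real))"
proof -
  let ?P = "\<lambda>f. \<exists>g. homeomorphism S3 S3 f g"
  have cong: "?P f \<longleftrightarrow> ?P g" if "\<And>x. x \<in> S3 \<Longrightarrow> f x = g x"
    for f g :: "complex \<times> complex \<Rightarrow> complex \<times> complex"
    using that by (metis homeomorphism_cong)
  have P: "?P (H s)" if s: "s \<in> {0..1}" for s
  proof -
    have "continuous_on S3 ((\<lambda>(s, x). H s x) \<circ> (\<lambda>x. (s, x)))"
      by (intro continuous_on_compose continuous_intros continuous_on_subset[OF cont])
        (use s in auto)
    then have "continuous_on S3 (H s)" by (simp add: o_def)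
    moreover have "compact S3" by (simp add: S3_def)
    ultimately show ?thesis
      using bij[OF s] homeomorphism_compact[of S3 "H s" S3] by (auto simp: bij_betw_def)
  qed
  have "H s x \<in> S3" if "s \<in> {0..1}" "x \<in> S3" for s x
    using bij_betw_apply[OF bij[OF that(1)] that(2)] .
  then have "(\<lambda>(s, x). H s x) \<in> {0..1} \<times> S3 \<rightarrow> S3"
    by (intro funcsetI) (simp only: mem_Times_iff case_prod_beta)
  then show ?thesis
    unfolding isotopic_to_id_def
    using cont P zero
    by (subst homotopic_with, use cong in \<open>metis topspace_euclidean_subtopology\<close>)
      (intro exI[of _ "\<lambda>(s, x). H s x"], auto simp only: prod_topology_subtopology_eu
        continuous_map_subtopology_eu prod.case id_apply topspace_euclidean_subtopology)
qed

section \<open>Rotations of a disc in the plane\<close>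

definition bump :: "real \<Rightarrow> real" where
  "bump r = max 0 (min 1 (2 - 2 * r))"

definition twist :: "complex \<Rightarrow> real \<Rightarrow> complex \<Rightarrow> complex" where
  "twist c \<alpha> z = c + (z - c) * cis (\<alpha> * bump (norm (z - c)))"

lemma twist_0 [simp]: "twist c 0 z = z"
  by (simp add: twist_def)

lemma twist_outside: "norm (z - c) \<ge> 1 \<Longrightarrow> twist c \<alpha> z = z"
  by (simp add: twist_def bump_def)

text \<open>A twist preserves the distance to \<open>c\<close>, so both twists turn \<open>z\<close>
  by multiples of the same \<open>bump\<close> value.\<close>

lemma twist_twist: "twist c \<alpha> (twist c \<beta> z) = twist c (\<alpha> + \<beta>) z"
proof -
  have "norm (twist c \<beta> z - c) = norm (z - c)" by (simp add: twist_def norm_mult)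
  then have "twist c \<alpha> (twist c \<beta> z) =
      c + (z - c) * (cis (\<beta> * bump (norm (z - c))) * cis (\<alpha> * bump (norm (z - c))))"
    by (simp add: twist_def[of c \<alpha>]) (simp add: twist_def)
  then show ?thesis by (simp add: cis_mult twist_def algebra_simps)
qed

lemma continuous_on_twist [continuous_intros]:
  assumes "continuous_on A f" "continuous_on A g"
  shows "continuous_on A (\<lambda>x. twist c (f x) (g x))"
  unfolding twist_def bump_def by (intro continuous_intros assms)

definition letter_angle :: "letter \<Rightarrow> real" where
  "letter_angle l = (if snd l then pi else - pi)"

abbreviation letter_centre :: "letter \<Rightarrow> complex" where
  "letter_centre l \<equiv> of_nat (fst l) + 1 / 2"

text \<open>The two moving points lie at distance 1/2 from the centre, where \<open>bump\<close> is
  1; all others lie outside its support. A letter is thus the trace of an isotopy of the whole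
  plane.\<close>

lemma letter_strand_twist:
  "letter_strand l p t = twist (letter_centre l) (letter_angle l * t) (of_nat p)"
proof -
  let ?c = "letter_centre l"
  have e: "cis (if snd l then pi * t else - (pi * t)) = cis (letter_angle l * t)"
    by (simp add: letter_angle_def)
  consider "p = fst l" | "p = fst l + 1" | "p < fst l" | "p > fst l + 1" by linarith
  then show ?thesis
  proof cases
    case 1
    then have "of_nat p - ?c = - (1 / 2)" by simp
    then show ?thesis using 1 by (simp add: letter_strand_def Let_def e twist_def bump_def)
  next
    case 2
    then have "of_nat p - ?c = 1 / 2" by (simp add: field_simps)
    then show ?thesis using 2 by (simp add: letter_strand_def Let_def e twist_def bump_def)
  next
    case 3
    have "of_nat p - ?c = of_real (real p - real (fst l) - 1 / 2)" by simp
    then have "norm (of_nat p - ?c) \<ge> 1" using 3 by (simp only: norm_of_real)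
    then show ?thesis using 3 by (simp add: letter_strand_def Let_def twist_outside)
  next
    case 4
    have "of_nat p - ?c = of_real (real p - real (fst l) - 1 / 2)" by simp
    then have "norm (of_nat p - ?c) \<ge> 1" using 4 by (simp only: norm_of_real)
    then show ?thesis using 4 by (simp add: letter_strand_def Let_def twist_outside)
  qed
qed

section \<open>Angular coordinate around the braid axis\<close>

definition angle :: "complex \<Rightarrow> real" where
  "angle b = Arg2pi b / (2 * pi)"

lemma angle_bounds: "0 \<le> angle b" "angle b < 1"
  using Arg2pi_ge_0[of b] Arg2pi_lt_2pi[of b] by (simp_all add: angle_def)

lemma angle_eq: "b = of_real (norm b) * cis (2 * pi * angle b)"
  using Arg2pi_eq[of b] by (simp add: angle_def cis_conv_exp)

lemma angle_scale [simp]: "r > 0 \<Longrightarrow> angle (of_real r * b) = angle b"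
  by (simp add: angle_def Arg2pi_times_of_real)

lemma cis_frac: "cis (2 * pi * frac t) = cis (2 * pi * t)"
proof -
  have "2 * pi * t = 2 * pi * frac t + 2 * pi * of_int \<lfloor>t\<rfloor>" by (simp add: frac_def algebra_simps)
  then have "cis (2 * pi * t) = cis (2 * pi * frac t) * cis (2 * pi * of_int \<lfloor>t\<rfloor>)"
    by (simp only: cis_mult)
  also have "cis (2 * pi * of_int \<lfloor>t\<rfloor>) = 1" by (rule cis_multiple_2pi) simp
  finally show ?thesis by simp
qed

lemma angle_cis [simp]: "angle (cis (2 * pi * t)) = frac t"
proof -
  have "cis (2 * pi * t) = exp (\<i> * of_real (2 * pi * frac t))"
    by (simp only: cis_frac cis_conv_exp[symmetric])
  moreover have "Arg2pi (exp (\<i> * of_real (2 * pi * frac t))) = 2 * pi * frac t"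
    by (subst Arg2pi_exp) (use frac_lt_1[of t] in auto)
  ultimately show ?thesis by (simp add: angle_def)
qed

lemma continuous_on_angle_off_cut:
  assumes "continuous_on {0..1} f"
  shows "continuous_on (- \<real>\<^sub>\<ge>\<^sub>0) (\<lambda>b. f (angle b))"
proof (rule continuous_on_compose2[OF assms])
  have "continuous_on (- \<real>\<^sub>\<ge>\<^sub>0) Arg2pi"
    by (intro continuous_at_imp_continuous_on ballI continuous_at_Arg2pi) auto
  then show "continuous_on (- \<real>\<^sub>\<ge>\<^sub>0) angle"
    unfolding angle_def by (intro continuous_intros) auto
qed (use angle_bounds in \<open>auto simp: less_imp_le\<close>)

lemma angle_uminus: "b \<noteq> 0 \<Longrightarrow> angle (- b) = frac (angle b + 1 / 2)"
proof -
  assume b: "b \<noteq> 0"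
  have "cis (2 * pi * (angle b + 1 / 2)) = - cis (2 * pi * angle b)"
    by (simp add: cis_mult[symmetric] distrib_left)
  then have "- b = of_real (norm b) * cis (2 * pi * (angle b + 1 / 2))"
    using angle_eq[of b] by simp
  then show ?thesis
    using b by (metis angle_cis angle_scale zero_less_norm_iff)
qed

text \<open>Equal end values let \<open>f\<close> descend to the circle. Across the cut of
  \<open>angle\<close>, \<open>f (angle b)\<close> is rewritten as \<open>g (angle (- b))\<close>,
  where \<open>g\<close> is \<open>f\<close> moved by half a period and \<open>- b\<close> avoids
  the cut.\<close>

lemma continuous_on_angle:
  assumes f: "continuous_on {0..1} f" "f 0 = f 1"
  shows "continuous_on (- {0}) (\<lambda>b. f (angle b))"
proof -
  define g where "g t = (if t \<le> 1 / 2 then f (t + 1 / 2) else f (t - 1 / 2))" for t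
  have eq: "f (t + 1 / 2) = f (t - 1 / 2)" if "t = 1 / 2" for t
    unfolding that using f(2) by simp
  have "continuous_on {0..1} g"
    unfolding g_def
    by (intro continuous_on_cases_le continuous_on_compose2[OF f(1)] continuous_intros)
      (auto simp: eq)
  then have "continuous_on (- \<real>\<^sub>\<ge>\<^sub>0) (\<lambda>b. g (angle b))" by (rule continuous_on_angle_off_cut)
  then have c: "continuous_on {b. 0 < Re b} (\<lambda>b. g (angle (- b)))"
    by (rule continuous_on_compose2) (auto intro!: continuous_intros simp: complex_nonneg_Reals_iff)
  have e: "g (angle (- b)) = f (angle b)" if "0 < Re b" for b
  proof -
    have "b \<noteq> 0" using that by auto
    show ?thesis
    proof (cases "angle b < 1 / 2")
      case True
      then have "frac (angle b + 1 / 2) = angle b + 1 / 2"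
        using angle_bounds[of b] by (simp add: frac_eq)
      then show ?thesis using True angle_bounds[of b] \<open>b \<noteq> 0\<close>
        by (cases "angle b = 0") (auto simp: angle_uminus g_def f(2))
    next
      case False
      then have "frac (angle b + 1 / 2) = angle b - 1 / 2"
        using angle_bounds[of b] by (simp add: frac_unique_iff)
      then show ?thesis using False angle_bounds[of b] \<open>b \<noteq> 0\<close>
        by (simp add: angle_uminus g_def)
    qed
  qed
  have 2: "continuous_on {b. 0 < Re b} (\<lambda>b. f (angle b))"
    using e by (intro continuous_on_eq[OF c]) simp
  have "- {0} = - \<real>\<^sub>\<ge>\<^sub>0 \<union> {b. 0 < Re b}"
    by (auto simp: complex_nonneg_Reals_iff complex_eq_iff)
  then show ?thesis
    using continuous_on_open_Un[OF _ _ continuous_on_angle_off_cut[OF f(1)] 2]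
    by (simp add: open_halfspace_Re_gt open_Compl)
qed

text \<open>
  In the coordinates \<open>z = a / \<bar>b\<bar>\<close> on the complement of the braid axis \<open>b = 0\<close>, this twists the page
  at \<open>b\<close> by the angle \<open>s * k b\<close>. The support stays away from the axis, and the map
  becomes one of the 3-sphere after normalisation.
\<close>

definition fibre_twist :: "complex \<Rightarrow> (complex \<Rightarrow> real) \<Rightarrow> real \<Rightarrow> complex \<times> complex \<Rightarrow> complex \<times> complex" where
  "fibre_twist c k s = (\<lambda>(a, b).
     (if b = 0 then a else of_real (norm b) * twist c (s * k b) (a / of_real (norm b)), b))"

lemma fibre_twist_scale:
  assumes k: "\<And>r b. r > 0 \<Longrightarrow> k (of_real r * b) = k b" and r: "r > 0"
  shows "fibre_twist c k s (r *\<^sub>R x) = r *\<^sub>R fibre_twist c k s x"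
  using r by (cases x) (auto simp: fibre_twist_def k scaleR_conv_of_real norm_mult)

lemma fibre_twist_inverse: "fibre_twist c k (- s) (fibre_twist c k s x) = x"
  by (cases x) (simp add: fibre_twist_def twist_twist)

lemma fibre_twist_0: "fibre_twist c k 0 x = x"
  by (cases x) (simp add: fibre_twist_def)

lemma fibre_twist_eq_0: "fibre_twist c k s x = 0 \<longleftrightarrow> x = 0"
proof -
  have "fibre_twist c k t 0 = 0" for t by (simp add: fibre_twist_def zero_prod_def)
  then show ?thesis by (metis fibre_twist_inverse)
qed

text \<open>Two open sets cover the domain: off the axis the formula is continuous, and on
  \<open>?V\<close>, which contains the axis without the origin, \<open>a / norm b\<close> is so far
  from \<open>c\<close> that nothing moves.\<close>

lemma continuous_on_fibre_twist:
  assumes k: "continuous_on (- {0}) k"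
  shows "continuous_on (UNIV \<times> - {0}) (\<lambda>(s, x). fibre_twist c k s x)"
proof -
  let ?U = "{(s, a, b). b \<noteq> 0} :: (real \<times> complex \<times> complex) set"
  let ?V = "{(s, a, b). norm b < norm (a - c * of_real (norm b))} :: (real \<times> complex \<times> complex) set"
  have "continuous_on ?U (\<lambda>y. (of_real (norm (snd (snd y))) *
      twist c (fst y * k (snd (snd y))) (fst (snd y) / of_real (norm (snd (snd y)))), snd (snd y)))"
    by (intro continuous_intros continuous_on_compose2[OF k]) auto
  then have U: "continuous_on ?U (\<lambda>(s, x). fibre_twist c k s x)"
    by (rule continuous_on_eq) (auto simp: fibre_twist_def)
  have "fibre_twist c k s (a, b) = (a, b)" if "norm b < norm (a - c * of_real (norm b))" for s a b
  proof (cases "b = 0")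
    case False
    then have "a - c * of_real (norm b) = of_real (norm b) * (a / of_real (norm b) - c)"
      by (simp add: field_simps)
    then have "norm (a - c * of_real (norm b)) = norm b * norm (a / of_real (norm b) - c)"
      by (simp add: norm_mult)
    then have "norm (a / of_real (norm b) - c) \<ge> 1" using that False by simp
    then show ?thesis using False by (simp add: fibre_twist_def twist_outside)
  qed (simp add: fibre_twist_def)
  then have V: "continuous_on ?V (\<lambda>(s, x). fibre_twist c k s x)"
    by (intro continuous_on_eq[OF continuous_on_snd[OF continuous_on_id]]) auto
  have "open ?U"
  proof -
    have "?U = (\<lambda>y. snd (snd y)) -` (- {0})" by auto
    then show ?thesis by (auto intro!: open_vimage continuous_intros)
  qed
  moreover have "open ?V"
    unfolding case_prod_beta by (intro open_Collect_less continuous_intros)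
  ultimately have "continuous_on (?U \<union> ?V) (\<lambda>(s, x). fibre_twist c k s x)"
    using U V by (intro continuous_on_open_Un)
  then show ?thesis by (rule continuous_on_subset) (auto simp: zero_prod_def)
qed

lemma S3_nonzero: "x \<in> S3 \<Longrightarrow> x \<noteq> 0"
  by (auto simp: S3_def)

lemma sgn_S3: "x \<noteq> 0 \<Longrightarrow> sgn x \<in> S3"
  by (simp add: S3_def norm_sgn)

text \<open>Twisting by the opposite angle is inverse to the twist. It commutes with positive
  scaling because \<open>k\<close> depends on the direction of \<open>b\<close> only, so this
  survives the normalisation.\<close>

lemma isotopic_to_id_fibre_twist:
  assumes k: "continuous_on (- {0}) k" "\<And>r b. r > 0 \<Longrightarrow> k (of_real r * b) = k b"
  shows "isotopic_to_id (\<lambda>x. sgn (fibre_twist c k 1 x))"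
proof (rule isotopic_to_idI[of "\<lambda>s x. sgn (fibre_twist c k s x)"])
  have "continuous_on ({0..1} \<times> S3) (\<lambda>(s, x). fibre_twist c k s x)"
    by (rule continuous_on_subset[OF continuous_on_fibre_twist[OF k(1)]]) (auto dest: S3_nonzero)
  then show "continuous_on ({0..1} \<times> S3) (\<lambda>(s, x). sgn (fibre_twist c k s x))"
    unfolding case_prod_beta
    by (intro continuous_on_sgn) (auto simp: fibre_twist_eq_0 dest: S3_nonzero)
  have inv: "sgn (fibre_twist c k (- s) (sgn (fibre_twist c k s x))) = x" if "x \<in> S3" for s x
  proof -
    let ?y = "fibre_twist c k s x"
    have "?y \<noteq> 0" using that by (simp add: fibre_twist_eq_0 S3_nonzero)
    then have "fibre_twist c k (- s) (sgn ?y) = inverse (norm ?y) *\<^sub>R x"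
      by (simp add: sgn_div_norm fibre_twist_scale[where k = k, OF k(2)] fibre_twist_inverse)
    then show ?thesis using \<open>?y \<noteq> 0\<close> that by (simp add: sgn_scaleR S3_def sgn_div_norm)
  qed
  have S3: "sgn (fibre_twist c k s x) \<in> S3" if "x \<in> S3" for s x
    using that by (simp add: sgn_S3 fibre_twist_eq_0 S3_nonzero)
  show "bij_betw (\<lambda>x. sgn (fibre_twist c k s x)) S3 S3" for s
    by (rule bij_betw_byWitness[where f' = "\<lambda>x. sgn (fibre_twist c k (- s) x)"])
      (use inv[of _ s] inv[of _ "- s"] S3 in auto)
  show "sgn (fibre_twist c k 0 x) = x" if "x \<in> S3" for x
    using that by (simp add: fibre_twist_0 sgn_div_norm S3_def)
qed

definition fibre_rotation :: "(real \<Rightarrow> real) \<Rightarrow> real \<Rightarrow> complex \<times> complex \<Rightarrow> complex \<times> complex" where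
  "fibre_rotation \<phi> s = (\<lambda>(a, b). (a, b * cis (2 * pi * (s * (\<phi> (angle b) - angle b)))))"

lemma fibre_rotation_polar:
  assumes "r \<ge> 0" "0 \<le> t" "t < 1"
  shows "fibre_rotation \<phi> s (a, of_real r * cis (2 * pi * t)) =
    (a, of_real r * cis (2 * pi * ((1 - s) * t + s * \<phi> t)))"
proof (cases "r = 0")
  case False
  then have "angle (of_real r * cis (2 * pi * t)) = t" using assms by (simp add: frac_eq)
  then show ?thesis
    by (simp add: fibre_rotation_def mult.assoc cis_mult algebra_simps)
qed (simp add: fibre_rotation_def)

text \<open>Off the axis, \<open>\<phi> t - t\<close> has equal end values and so is continuous
  around the circle. On the axis the rotating factor has modulus 1, so the product tends to 0 with
  \<open>b\<close>.\<close>

lemma continuous_on_fibre_rotation: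
  assumes "continuous_on {0..1} \<phi>" "\<phi> 1 = \<phi> 0 + 1"
  shows "continuous_on UNIV (\<lambda>(s, x). fibre_rotation \<phi> s x)"
proof -
  let ?k = "\<lambda>b. \<phi> (angle b) - angle b"
  let ?g = "\<lambda>y::real \<times> complex \<times> complex.
    snd (snd y) * cis (2 * pi * (fst y * ?k (snd (snd y))))"
  have k: "continuous_on (- {0}) ?k"
    using continuous_on_angle[of "\<lambda>t. \<phi> t - t"] assms by (simp add: continuous_intros)
  let ?U = "(\<lambda>y. snd (snd y)) -` (- {0}) :: (real \<times> complex \<times> complex) set"
  have "open ?U" by (auto intro!: open_vimage continuous_intros)
  moreover have "continuous_on ?U ?g"
    by (intro continuous_intros continuous_on_compose2[OF k]) auto
  ultimately have 1: "isCont ?g y" if "snd (snd y) \<noteq> 0" for y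
    using that by (simp add: continuous_on_eq_continuous_at)
  have 2: "isCont ?g y" if y: "snd (snd y) = 0" for y
  proof -
    have "((\<lambda>y. norm (snd (snd y))) \<longlongrightarrow> norm (snd (snd y))) (at y)"
      by (intro tendsto_intros)
    then have "(?g \<longlongrightarrow> 0) (at y)"
      by (intro tendsto_norm_zero_cancel[of ?g]) (simp add: norm_mult y)
    then show ?thesis by (simp add: isCont_def y)
  qed
  have "continuous_on UNIV ?g" using 1 2 by (meson continuous_at_imp_continuous_on)
  then have "continuous_on UNIV (\<lambda>y. (fst (snd y), ?g y))"
    by (rule continuous_on_Pair[OF continuous_on_fst[OF continuous_on_snd[OF continuous_on_id]]])
  then show ?thesis by (simp add: fibre_rotation_def case_prod_beta')
qed

text \<open>The interpolation \<open>\<psi>\<close> between the identity and \<open>\<phi>\<close>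
  increases strictly, by exactly 1 over the unit interval, so it induces a bijection of the
  circle.\<close>

lemma bij_fibre_rotation:
  assumes \<phi>: "continuous_on {0..1} \<phi>" "\<phi> 1 = \<phi> 0 + 1" "strict_mono_on {0..1} \<phi>"
    and s: "s \<in> {0..1}"
  shows "bij_betw (fibre_rotation \<phi> s) S3 S3"
proof -
  define \<psi> where "\<psi> t = (1 - s) * t + s * \<phi> t" for t
  have cont: "continuous_on {0..1} \<psi>" unfolding \<psi>_def by (intro continuous_intros \<phi>)
  have one: "\<psi> 1 = \<psi> 0 + 1" by (simp add: \<psi>_def \<phi>(2) algebra_simps)
  have less: "\<psi> t < \<psi> u" if "0 \<le> t" "t < u" "u \<le> 1" for t u
  proof -
    have "\<phi> t < \<phi> u" using that \<phi>(3) by (auto simp: strict_mono_on_def)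
    then show ?thesis unfolding \<psi>_def using s that
      by (cases "s = 0") (auto intro!: add_le_less_mono mult_left_mono mult_strict_left_mono)
  qed
  have polar: "\<exists>r t. x = (a, of_real r * cis (2 * pi * t)) \<and> 0 \<le> r \<and> 0 \<le> t \<and> t < 1"
    if "x = (a, b)" for x a b
    using angle_eq[of b] angle_bounds[of b] that
    by (intro exI[of _ "norm b"] exI[of _ "angle b"]) simp
  have norm: "norm (fibre_rotation \<phi> s x) = norm x" for x
    by (cases x) (simp add: fibre_rotation_def norm_Pair norm_mult)
  have "inj_on (fibre_rotation \<phi> s) S3"
  proof (rule inj_onI)
    fix x y assume e: "fibre_rotation \<phi> s x = fibre_rotation \<phi> s y"
    obtain a b a' b' where ab: "x = (a, b)" "y = (a', b')" by (cases x, cases y)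
    from polar[OF ab(1)] obtain r t where x: "x = (a, of_real r * cis (2 * pi * t))"
      "0 \<le> r" "0 \<le> t" "t < 1" by blast
    from polar[OF ab(2)] obtain r' t' where y: "y = (a', of_real r' * cis (2 * pi * t'))"
      "0 \<le> r'" "0 \<le> t'" "t' < 1" by blast
    have e': "a = a'" "of_real r * cis (2 * pi * \<psi> t) = of_real r' * cis (2 * pi * \<psi> t')"
      using e x y by (simp_all add: fibre_rotation_polar \<psi>_def)
    from arg_cong[OF e'(2), of norm] have r: "r = r'" using x y by (simp add: norm_mult)
    show "x = y"
    proof (cases "r = 0")
      case False
      then have "cis (2 * pi * \<psi> t) = cis (2 * pi * \<psi> t')" using e' r by simp
      then have "frac (\<psi> t) = frac (\<psi> t')" by (metis angle_cis)
      then have "\<psi> t - \<psi> t' = of_int (\<lfloor>\<psi> t\<rfloor> - \<lfloor>\<psi> t'\<rfloor>)" by (simp add: frac_def)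
      then have z: "\<psi> t - \<psi> t' \<in> \<int>" by (simp only: Ints_of_int)
      have b: "\<psi> 0 \<le> \<psi> t" "\<psi> t < \<psi> 1" "\<psi> 0 \<le> \<psi> t'" "\<psi> t' < \<psi> 1"
        using less[of 0 t] less[of t 1] less[of 0 t'] less[of t' 1] x y
        by (cases "t = 0"; cases "t' = 0"; force)+
      then have "\<bar>\<psi> t - \<psi> t'\<bar> < 1" using one by linarith
      then have "\<psi> t = \<psi> t'" using z Ints_nonzero_abs_ge1[OF z] by linarith
      then have "t = t'" using less[of t t'] less[of t' t] x y by (cases t t' rule: linorder_cases) auto
      then show ?thesis using x y r e' by simp
    qed (use x y r e' in simp)
  qed
  moreover have "fibre_rotation \<phi> s ` S3 = S3"
  proof
    show "fibre_rotation \<phi> s ` S3 \<subseteq> S3" by (auto simp: S3_def norm)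
    show "S3 \<subseteq> fibre_rotation \<phi> s ` S3"
    proof
      fix y assume y3: "y \<in> S3"
      obtain a b where "y = (a, b)" by (cases y)
      from polar[OF this] obtain r u where y: "y = (a, of_real r * cis (2 * pi * u))"
        "0 \<le> r" "0 \<le> u" "u < 1" by blast
      \<comment> \<open>Whole number of turns that brings the target angle \<open>u\<close> into the
        range of \<open>\<psi>\<close>.\<close>
      define n where "n = \<lceil>\<psi> 0 - u\<rceil>"
      have n: "\<psi> 0 \<le> u + n" "u + n < \<psi> 1" unfolding n_def one by linarith+
      obtain t where t: "0 \<le> t" "t \<le> 1" "\<psi> t = u + n"
        using IVT'[of \<psi> 0 "u + n" 1] n cont by auto
      have "t < 1" using t n(2) by (cases "t = 1") auto
      have "cis (2 * pi * (u + n)) = cis (2 * pi * u) * cis (2 * pi * n)"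
        by (simp only: cis_mult distrib_left)
      then have "cis (2 * pi * \<psi> t) = cis (2 * pi * u)" by (simp add: t(3) cis_multiple_2pi)
      then have "y = fibre_rotation \<phi> s (a, of_real r * cis (2 * pi * t))"
        using y t \<open>t < 1\<close> by (simp add: fibre_rotation_polar \<psi>_def)
      then show "y \<in> fibre_rotation \<phi> s ` S3" using y3 norm by (auto simp: S3_def)
    qed
  qed
  ultimately show ?thesis by (simp add: bij_betw_def)
qed

lemma isotopic_to_id_fibre_rotation:
  assumes "continuous_on {0..1} \<phi>" "\<phi> 1 = \<phi> 0 + 1" "strict_mono_on {0..1} \<phi>"
  shows "isotopic_to_id (fibre_rotation \<phi> 1)"
  using continuous_on_subset[OF continuous_on_fibre_rotation[OF assms(1,2)]] bij_fibre_rotation[OF assms]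
  by (intro isotopic_to_idI) (auto simp: fibre_rotation_def)

section \<open>Cyclic permutation of pure braid words\<close>

text \<open>
  The letters of a word occupy the time intervals \<open>[0, 1/2]\<close>, \<open>[1/2, 3/4]\<close>, \<open>\<dots>\<close>, and the strands are
  at rest from the time below until 1.
\<close>

definition rest_start :: "letter list \<Rightarrow> real" where
  "rest_start w = 1 - (1 / 2) ^ length w"

lemma rest_start_simps [simp]:
  "rest_start [] = 0"
  "rest_start (l # w) = (1 + rest_start w) / 2"
  by (simp_all add: rest_start_def field_simps)

lemma rest_start_bounds: "0 \<le> rest_start w" "rest_start w < 1"
  by (simp_all add: rest_start_def power_le_one)

lemma strand_Cons_late:
  assumes "1 / 2 \<le> t"
  shows "strand (l # w) p t = strand w (Transposition.transpose (fst l) (fst l + 1) p) (2 * t - 1)"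
proof (cases "t = 1 / 2")
  case True
  show ?thesis unfolding True by (simp add: joinpaths_def letter_strand_1 strand_0)
qed (use assms in \<open>simp add: joinpaths_def\<close>)

lemma strand_Cons_early: "t \<le> 1 / 2 \<Longrightarrow> strand (l # w) p t = letter_strand l p (2 * t)"
  by (simp add: joinpaths_def)

declare strand.simps(2) [simp del]

lemma strand_rest: "rest_start w \<le> t \<Longrightarrow> strand w p t = of_nat (word_perm w p)"
proof (induction w arbitrary: p t)
  case (Cons l w)
  have "1 / 2 \<le> t" using Cons.prems rest_start_bounds[of w] by simp
  then show ?case using Cons by (simp add: strand_Cons_late)
qed simp

lemma strand_snoc_early:
  "t \<le> rest_start w \<Longrightarrow> 0 \<le> t \<Longrightarrow> strand (w @ [l]) p t = strand w p t"
proof (induction w arbitrary: p t)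
  case Nil
  then show ?case by (simp add: strand_0)
next
  case (Cons a w)
  then show ?case
    by (cases "t \<le> 1 / 2") (simp_all add: strand_Cons_late strand_Cons_early)
qed

text \<open>The appended letter is performed in the first half of the resting interval of
  \<open>w\<close>. The minimum with 1 keeps it at its final position afterwards.\<close>

lemma strand_snoc_late:
  "rest_start w \<le> t \<Longrightarrow> t \<le> 1 \<Longrightarrow>
    strand (w @ [l]) p t = letter_strand l (word_perm w p) (min 1 (2 * (t - rest_start w) / (1 - rest_start w)))"
proof (induction w arbitrary: p t)
  case Nil
  then show ?case
    by (cases "t \<le> 1 / 2") (simp_all add: strand_Cons_late strand_Cons_early letter_strand_1)
next
  case (Cons a w)
  let ?x = "rest_start w"
  have "1 / 2 \<le> t" using Cons.prems rest_start_bounds[of w] by simp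
  moreover have "2 * (t - (1 + ?x) / 2) / (1 - (1 + ?x) / 2) = 2 * ((2 * t - 1) - ?x) / (1 - ?x)"
    using rest_start_bounds[of w] by (simp add: divide_simps) (simp add: algebra_simps)
  ultimately show ?case
    using Cons.IH[of "2 * t - 1"] Cons.prems by (simp add: strand_Cons_late)
qed

section \<open>Closures of pure words\<close>

lemma orbit_id: "orbit id p = {p}"
proof -
  have "q = p" if "q \<in> orbit id p" for q using that by induction simp_all
  then show ?thesis using orbit.base[of id p] by auto
qed

lemma closed_braid_pure: "word_perm w = id \<Longrightarrow> closed_braid m w = strand_in_S3 w ` {1..m}"
  by (auto simp: closed_braid_def orbit_id)

lemma inj_strand_in_S3: "inj (strand_in_S3 w)"
proof (rule injI)
  fix p q assume "strand_in_S3 w p = strand_in_S3 w q"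
  then show "p = q" using strand_in_S3_eq[of w p 0 q 0] by auto
qed

text \<open>
  The resting period of \<open>l # w\<close> precedes, cyclically, the letter \<open>l\<close>, whereas that of \<open>w @ [l]\<close>
  follows it. Hence reparametrising time is not enough: after the reparametrisation
  \<open>shift_time\<close> the two closed braids differ by a twist of the strands moved by \<open>l\<close>, by the fraction
  \<open>shift_angle\<close> of a half turn.
\<close>

definition shift_time :: "letter list \<Rightarrow> real \<Rightarrow> real" where
  "shift_time w t = (let x = rest_start w in
     if t \<le> x then (t + 1) / 2 else (x + 1) / 2 + (t - x) * ((1 - x / 2) / (1 - x)))"

text \<open>Progress of the letter \<open>l\<close> in \<open>l # w\<close> once the shifted time
  has passed 1, minus its progress in \<open>w @ [l]\<close>.\<close>

definition shift_angle :: "letter list \<Rightarrow> real \<Rightarrow> real" where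
  "shift_angle w t = max 0 (2 * shift_time w t - 2) -
     max 0 (min 1 (2 * (t - rest_start w) / (1 - rest_start w)))"

text \<open>One full turn, begun just after \<open>l\<close> in \<open>l # w\<close>: the part
  carrying \<open>w\<close> is matched first, then the rest of \<open>w @ [l]\<close> covers the
  rest of \<open>l # w\<close> and the \<open>l\<close> of the next turn.\<close>

lemma shift_time_ends: "shift_time w 0 = 1 / 2" "shift_time w 1 = 3 / 2"
  using rest_start_bounds[of w] by (simp_all add: shift_time_def Let_def field_simps)

lemma continuous_on_shift_time: "continuous_on {0..1} (shift_time w)"
proof -
  have "rest_start w \<noteq> 1" using rest_start_bounds[of w] by simp
  then show ?thesis
    unfolding shift_time_def[abs_def] Let_def
    by (intro continuous_on_cases_le continuous_intros) auto
qed

lemma strict_mono_shift_time: "strict_mono_on {0..1} (shift_time w)"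
proof (rule strict_mono_onI)
  fix t u :: real assume "t < u"
  let ?x = "rest_start w"
  have c: "(1 - ?x / 2) / (1 - ?x) > 0" using rest_start_bounds[of w] by (simp add: field_simps)
  consider "u \<le> ?x" | "t \<le> ?x" "?x < u" | "?x < t" using \<open>t < u\<close> by linarith
  then show "shift_time w t < shift_time w u"
  proof cases
    case 2
    then have "(u - ?x) * ((1 - ?x / 2) / (1 - ?x)) > 0" using c by (intro mult_pos_pos) auto
    moreover have "shift_time w t = (t + 1) / 2"
      "shift_time w u = (?x + 1) / 2 + (u - ?x) * ((1 - ?x / 2) / (1 - ?x))"
      using 2 by (simp_all add: shift_time_def Let_def)
    moreover have "(t + 1) / 2 \<le> (?x + 1) / 2" using 2 by simp
    ultimately show ?thesis by linarith
  next
    case 3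
    then have "(t - ?x) * ((1 - ?x / 2) / (1 - ?x)) < (u - ?x) * ((1 - ?x / 2) / (1 - ?x))"
      using c \<open>t < u\<close> by (intro mult_strict_right_mono) auto
    then show ?thesis using 3 \<open>t < u\<close> by (simp add: shift_time_def Let_def del: times_divide_eq_right)
  qed (use \<open>t < u\<close> in \<open>simp add: shift_time_def\<close>)
qed

text \<open>The two progresses agree at both ends (0 and 0, then 1 and 1), so the angle is a
  function on the circle of pages.\<close>

lemma shift_angle_ends: "shift_angle w 0 = 0" "shift_angle w 1 = 0"
proof -
  have "max 0 (min 1 (- y)) = 0" if "0 \<le> y" for y :: real using that by simp
  from this[of "2 * rest_start w / (1 - rest_start w)"]
  show "shift_angle w 0 = 0" "shift_angle w 1 = 0"
    using rest_start_bounds[of w] by (simp_all add: shift_angle_def shift_time_ends)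
qed

lemma continuous_on_shift_angle: "continuous_on {0..1} (shift_angle w)"
proof -
  have "rest_start w \<noteq> 1" using rest_start_bounds[of w] by simp
  then show ?thesis
    unfolding shift_angle_def[abs_def] by (intro continuous_intros continuous_on_shift_time) simp
qed

text \<open>While \<open>w\<close> runs, both strands coincide. Later both are positions on the
  strand \<open>p\<close> of the single letter \<open>l\<close>, at progresses that differ by
  \<open>shift_angle\<close>; since twists add up, a twist carries one to the other.\<close>

lemma strand_shift:
  assumes t: "0 \<le> t" "t < 1"
    and pq: "q = Transposition.transpose (fst l) (fst l + 1) p" "word_perm w q = p"
  shows "strand (l # w) p (frac (shift_time w t)) =
    twist (letter_centre l) (letter_angle l * shift_angle w t) (strand (w @ [l]) q t)"
proof (cases "t \<le> rest_start w")
  let ?x = "rest_start w" and ?u = "shift_time w t"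
  have x: "0 \<le> ?x" "?x < 1" by (rule rest_start_bounds)+
  {
    case True
    have u: "?u = (t + 1) / 2" using True by (simp add: shift_time_def)
    then have "frac ?u = (t + 1) / 2" using t by (simp add: frac_eq)
    then have 1: "strand (l # w) p (frac ?u) = strand w q t"
      using t by (simp add: strand_Cons_late pq) (simp add: field_simps)
    have "2 * (t - ?x) / (1 - ?x) \<le> 0" using True x by (simp add: divide_le_0_iff)
    then have "shift_angle w t = 0" using u t by (simp add: shift_angle_def)
    then show ?thesis using 1 True t by (simp add: strand_snoc_early)
  next
    case False
    let ?v = "min 1 (2 * (t - ?x) / (1 - ?x))"
    have v: "?v \<ge> 0" using False x by simp
    have 1: "strand (l # w) p (frac ?u) = letter_strand l p (max 0 (2 * ?u - 2))"
    proof (cases "?u < 1")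
      case True
      have "(?x + 1) / 2 \<le> ?u" using False x by (simp add: shift_time_def Let_def)
      then have "?x \<le> 2 * ?u - 1" "1 / 2 \<le> ?u" using x by auto
      moreover from this have "frac ?u = ?u" using True by (simp add: frac_eq)
      ultimately show ?thesis
        using True pq(2)[unfolded pq(1)]
        by (simp add: strand_Cons_late strand_rest letter_strand_0)
    next
      case False
      have "?u < 3 / 2"
        using strict_mono_onD[OF strict_mono_shift_time, of t 1 w] t by (simp add: shift_time_ends)
      then have fr: "frac ?u = ?u - 1" using False by (simp add: frac_unique_iff)
      show ?thesis
        unfolding fr using False \<open>?u < 3 / 2\<close> by (simp add: strand_Cons_early algebra_simps)
    qed
    have "strand (w @ [l]) q t = letter_strand l p ?v"
      using False t pq by (simp add: strand_snoc_late)
    then show ?thesis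
      unfolding 1 using v
      by (simp add: letter_strand_twist twist_twist shift_angle_def distrib_left[symmetric]
          del: of_nat_Suc)
  }
qed

section \<open>From strands to curves in the 3-sphere\<close>

lemma fibre_twist_sgn:
  assumes "\<And>r b. r > 0 \<Longrightarrow> k (of_real r * b) = k b" "norm u = 1"
  shows "sgn (fibre_twist c k 1 (sgn (z, u))) = sgn (twist c (k u) z, u)"
proof -
  have nz: "norm (z, u) \<noteq> 0" "u \<noteq> 0" using assms(2) by (auto simp: zero_prod_def)
  have "fibre_twist c k 1 (sgn (z, u)) = inverse (norm (z, u)) *\<^sub>R fibre_twist c k 1 (z, u)"
    unfolding sgn_div_norm by (rule fibre_twist_scale) (use nz assms(1) in auto)
  also have "fibre_twist c k 1 (z, u) = (twist c (k u) z, u)"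
    using nz assms(2) by (simp add: fibre_twist_def)
  finally show ?thesis using nz by (simp only: sgn_scaleR sgn_inverse) simp
qed

lemma fibre_rotation_sgn:
  assumes "0 \<le> t" "t < 1"
  shows "fibre_rotation \<phi> 1 (sgn (z, cis (2 * pi * t))) = sgn (z, cis (2 * pi * \<phi> t))"
proof -
  let ?r = "inverse (norm (z, cis (2 * pi * t)))"
  have "sgn (z, cis (2 * pi * t)) = (of_real ?r * z, of_real ?r * cis (2 * pi * t))"
    by (simp add: sgn_div_norm scaleR_conv_of_real)
  moreover have "sgn (z, cis (2 * pi * \<phi> t)) = (of_real ?r * z, of_real ?r * cis (2 * pi * \<phi> t))"
    by (simp add: sgn_div_norm scaleR_conv_of_real norm_Pair)
  ultimately show ?thesis using fibre_rotation_polar[of ?r t \<phi> 1] assms by simp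
qed

text \<open>The lift \<open>\<psi>\<close> extends \<open>\<phi>\<close> by
  \<open>\<psi> (s + 1) = \<psi> s + 1\<close>. Its continuity at the integers comes from viewing
  \<open>\<phi> t - t\<close> as a function on the circle.\<close>

lemma same_oriented_curve_reparametrise:
  assumes \<phi>: "continuous_on {0..1} \<phi>" "\<phi> 1 = \<phi> 0 + 1" "strict_mono_on {0..1} \<phi>"
    and eq: "\<And>t. 0 \<le> t \<Longrightarrow> t < 1 \<Longrightarrow> \<delta> t = \<gamma> (frac (\<phi> t))"
  shows "same_oriented_curve \<gamma> \<delta>"
proof -
  define \<psi> where "\<psi> s = s + (\<phi> (frac s) - frac s)" for s
  have fr: "\<psi> s = of_int \<lfloor>s\<rfloor> + \<phi> (frac s)" for s by (simp add: \<psi>_def frac_def)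
  have k: "continuous_on (- {0}) (\<lambda>b. \<phi> (angle b) - angle b)"
    using continuous_on_angle[of "\<lambda>t. \<phi> t - t"] \<phi> by (simp add: continuous_intros)
  have "continuous_on UNIV (\<lambda>s. \<phi> (angle (cis (2 * pi * s))) - angle (cis (2 * pi * s)))"
    by (rule continuous_on_compose2[OF k]) (auto intro!: continuous_intros)
  then have "continuous_on UNIV \<psi>"
    unfolding \<psi>_def angle_cis by (intro continuous_on_add continuous_on_id)
  moreover have "strict_mono \<psi>"
  proof (rule strict_monoI)
    fix s u :: real assume "s < u"
    have f: "0 \<le> frac s" "frac s < 1" "0 \<le> frac u" "frac u < 1"
      by (simp_all add: frac_lt_1)
    show "\<psi> s < \<psi> u"
    proof (cases "\<lfloor>s\<rfloor> = \<lfloor>u\<rfloor>")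
      case True
      then have "frac s < frac u" using \<open>s < u\<close> by (simp add: frac_def)
      then have "\<phi> (frac s) < \<phi> (frac u)" using strict_mono_onD[OF \<phi>(3)] f by simp
      then show ?thesis by (simp add: fr True)
    next
      case False
      then have "\<lfloor>s\<rfloor> + 1 \<le> \<lfloor>u\<rfloor>" using floor_mono[of s u] \<open>s < u\<close> by linarith
      then have "of_int \<lfloor>s\<rfloor> + 1 \<le> (of_int \<lfloor>u\<rfloor> :: real)" by linarith
      moreover have "\<phi> (frac s) < \<phi> 1" using strict_mono_onD[OF \<phi>(3), of "frac s" 1] f by simp
      moreover have "\<phi> 0 \<le> \<phi> (frac u)"
      proof (cases "frac u = 0")
        case False
        then have "0 < frac u" using f(3) by linarith
        from strict_mono_onD[OF \<phi>(3) _ _ this] f show ?thesis by simp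
      next
        case True
        show ?thesis unfolding True by simp
      qed
      ultimately show ?thesis unfolding fr using \<phi>(2) by linarith
    qed
  qed
  moreover have "\<psi> (s + 1) = \<psi> s + 1" for s by (simp add: \<psi>_def frac_1_eq)
  moreover have "\<delta> (frac s) = \<gamma> (frac (\<psi> s))" for s
  proof -
    have "frac (\<psi> s) = frac (\<phi> (frac s))" by (simp add: fr frac_def)
    then show ?thesis using eq[of "frac s"] by (simp add: frac_lt_1)
  qed
  ultimately show ?thesis unfolding same_oriented_curve_def by blast
qed

lemma word_perm_snoc:
  "word_perm (u @ [l]) = Transposition.transpose (fst l) (fst l + 1) \<circ> word_perm u"
  by (induction u) (auto simp: fun_eq_iff)

lemma word_perm_rotate:
  assumes "word_perm (l # w) = id"
  shows "word_perm w = Transposition.transpose (fst l) (fst l + 1)" "word_perm (w @ [l]) = id"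
proof -
  let ?\<tau> = "Transposition.transpose (fst l) (fst l + 1)"
  have "word_perm w (?\<tau> p) = p" for p using fun_cong[OF assms, of p] by simp
  from this[of "?\<tau> _"] show "word_perm w = ?\<tau>" by (simp add: fun_eq_iff)
  then show "word_perm (w @ [l]) = id" unfolding word_perm_snoc by (simp add: fun_eq_iff)
qed

text \<open>The isotopy first twists the pages by \<open>shift_angle\<close> and then moves them by
  \<open>shift_time\<close>.\<close>

lemma closed_braid_shift:
  assumes w: "l # w \<in> artin_words m" and pure: "word_perm (l # w) = id"
  shows "link_isotopic (closed_braid m (w @ [l])) (closed_braid m (l # w))"
proof -
  define \<tau> where "\<tau> = Transposition.transpose (fst l) (fst l + 1)"
  define S where "S = strand_in_S3 (w @ [l])"
  define S' where "S' = strand_in_S3 (l # w)"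
  define k where "k b = letter_angle l * shift_angle w (angle b)" for b
  define F where "F x = sgn (fibre_twist (letter_centre l) k 1 x)" for x
  define h where "h = fibre_rotation (shift_time w) 1 \<circ> F"
  have \<tau>2 [simp]: "\<tau> (\<tau> p) = p" for p by (simp add: \<tau>_def)
  have closed: "closed_braid m (w @ [l]) = S ` {1..m}" "closed_braid m (l # w) = S' ` {1..m}"
    unfolding S_def S'_def using word_perm_rotate[OF pure] pure closed_braid_pure by blast+
  have k: "k (of_real r * b) = k b" if "r > 0" for r b using that by (simp add: k_def)
  have st: "shift_time w 1 = shift_time w 0 + 1" by (simp add: shift_time_ends)
  have "continuous_on (- {0}) k"
    unfolding k_def
    by (intro continuous_intros continuous_on_angle continuous_on_shift_angle)
      (simp add: shift_angle_ends)
  then have "isotopic_to_id F" unfolding F_def using k by (rule isotopic_to_id_fibre_twist)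
  then have h: "isotopic_to_id h"
    unfolding h_def
    by (rule isotopic_to_id_compose)
      (intro isotopic_to_id_fibre_rotation continuous_on_shift_time strict_mono_shift_time st)
  have "\<tau> permutes {1..m}"
    unfolding \<tau>_def using w by (intro permutes_swap_id) (auto simp: artin_words_def)
  then have \<tau>: "bij_betw \<tau> {1..m} {1..m}" by (rule permutes_imp_bij)
  have inj: "inj S" "inj S'" unfolding S_def S'_def by (rule inj_strand_in_S3)+
  have "bij_betw (inv_into UNIV S) (S ` {1..m}) {1..m}"
    using inj(1) by (intro bij_betw_byWitness[where f' = S]) auto
  moreover have "bij_betw S' {1..m} (S' ` {1..m})"
    using inj(2) by (intro inj_on_imp_bij_betw) (auto intro: inj_on_subset)
  \<comment> \<open>Strand \<open>q\<close> of \<open>w @ [l]\<close> starts where strand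
    \<open>\<tau> q\<close> of \<open>l # w\<close> is after its first letter, hence this matching
    of components.\<close>
  ultimately have "bij_betw (S' \<circ> (\<tau> \<circ> inv_into UNIV S)) (S ` {1..m}) (S' ` {1..m})"
    using \<tau> by (blast intro: bij_betw_trans)
  moreover have "same_oriented_curve (h \<circ> \<gamma>) ((S' \<circ> (\<tau> \<circ> inv_into UNIV S)) \<gamma>)" if \<gamma>: "\<gamma> \<in> S ` {1..m}" for \<gamma>
  proof -
    obtain q where q: "\<gamma> = S q" using \<gamma> by blast
    have pq: "q = Transposition.transpose (fst l) (fst l + 1) (\<tau> q)" "word_perm w q = \<tau> q"
      using \<tau>2[of q] word_perm_rotate(1)[OF pure] by (simp_all add: \<tau>_def)
    have "h (S q t) = S' (\<tau> q) (frac (shift_time w t))" if t: "0 \<le> t" "t < 1" for t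
    proof -
      have "k (cis (2 * pi * t)) = letter_angle l * shift_angle w t"
        using t by (simp add: k_def frac_eq)
      then have "F (S q t) = sgn (strand (l # w) (\<tau> q) (frac (shift_time w t)), cis (2 * pi * t))"
        unfolding F_def S_def strand_in_S3_def
        using fibre_twist_sgn[where k = k, OF k] strand_shift[OF t pq] by simp
      then show ?thesis
        using t by (simp add: h_def S'_def strand_in_S3_def fibre_rotation_sgn cis_frac)
    qed
    then have "same_oriented_curve (S' (\<tau> q)) (h \<circ> S q)"
      by (intro same_oriented_curve_reparametrise[OF continuous_on_shift_time st strict_mono_shift_time])
        simp
    then show ?thesis using inj(1) by (simp add: q same_oriented_curve_sym)
  qed
  ultimately show ?thesis unfolding link_isotopic_def closed using h by blast
qed

lemma closed_braid_cyclic_permutation: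
  assumes "u @ v \<in> artin_words m" "word_perm (u @ v) = id"
  shows "link_isotopic (closed_braid m (v @ u)) (closed_braid m (u @ v))"
  using assms
proof (induction u arbitrary: v)
  case (Cons l u)
  have pure: "word_perm (l # (u @ v)) = id" using Cons.prems(2) by (simp only: append_Cons)
  have "u @ (v @ [l]) \<in> artin_words m" "word_perm (u @ (v @ [l])) = id"
    using Cons.prems(1) word_perm_rotate(2)[OF pure] by (auto simp: artin_words_def)
  from Cons.IH[OF this] closed_braid_shift[OF _ pure, of m] Cons.prems(1)
  show ?case by (auto intro: link_isotopic_trans)
qed (simp add: link_isotopic_refl)

section \<open>Links with a gap\<close>

lemma link_isotopic_card: "link_isotopic L L' \<Longrightarrow> card L = card L'"
  unfolding link_isotopic_def by (blast intro: bij_betw_same_card)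

lemma card_closed_braid_le: "card (closed_braid m w) \<le> m"
proof -
  have "closed_braid m w \<subseteq> (\<lambda>p. turns w (card (orbit (word_perm w) p) - 1) p) ` {1..m}"
    by (auto simp: closed_braid_def)
  then show ?thesis using surj_card_le[of "{1..m}"] by simp
qed

lemma card_closed_braid_pure: "word_perm w = id \<Longrightarrow> card (closed_braid m w) = m"
  unfolding closed_braid_pure
  using card_image[OF inj_on_subset[OF inj_strand_in_S3 subset_UNIV], of w "{1..m}"] by simp

text \<open>A pure closure has one component per strand, any closure has at most one per strand, and
  isotopy preserves the number of components.\<close>

lemma pure_braid_minimal_index:
  assumes "word_perm w = id" "\<And>L. L \<in> K \<Longrightarrow> link_isotopic (closed_braid m w) L"
    and "braid_representative m' \<beta> K"
  shows "m \<le> m'"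
  using assms card_closed_braid_pure[of w m] card_closed_braid_le link_isotopic_card
  unfolding braid_representative_def by metis

lemma word_perm_twisted: "word_perm (twisted_word n) = id"
proof -
  let ?\<tau> = "Transposition.transpose 2 3 :: nat \<Rightarrow> nat"
  have r: "word_perm (replicate n (2, b) @ w) p = word_perm w ((?\<tau> ^^ n) p)" for b w p
    by (induction n arbitrary: p) (simp_all add: funpow_swap1)
  have "(?\<tau> ^^ n) ((?\<tau> ^^ n) p) = p" for p
    by (induction n) (simp_all add: funpow_swap1)
  then show ?thesis
    using r[of _ "[]"] by (simp add: fun_eq_iff twisted_word_def r)
qed

theorem theorem1p8:
  shows "\<exists>K :: nat \<Rightarrow> closed_curve set set. \<forall>n\<ge>1.
    K n \<in> link_types \<and>
    (\<exists>m \<beta>. braid_representative m \<beta> (K n) \<and>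
       (\<forall>m' \<beta>'. braid_representative m' \<beta>' (K n) \<longrightarrow> m \<le> m') \<and>
       int (nb_braid m \<beta>) - int (nb_link (K n)) = int n)"
proof (intro exI allI impI conjI)
  let ?R = "{(L, L'). L \<in> oriented_links \<and> L' \<in> oriented_links \<and> link_isotopic L L'}"
  let ?K = "\<lambda>n. ?R `` {closed_braid 3 (twisted_word n)}"
  fix n :: nat assume n: "n \<ge> 1"
  let ?u = "replicate n (2, False) :: letter list"
  let ?v = "[(1, True), (1, True)] @ replicate n (2, True) :: letter list"
  have words: "twisted_word n \<in> artin_words 3" "?v @ ?u \<in> artin_words 3"
    by (auto simp: twisted_word_def artin_words_def)
  have links: "closed_braid 3 (twisted_word n) \<in> oriented_links" "closed_braid 3 (?v @ ?u) \<in> oriented_links"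
    using words by (auto intro!: closed_braid_link simp del: append.simps append_assoc)
  show "?K n \<in> link_types" unfolding link_types_def using links(1) by (rule quotientI)
  have self: "w \<in> braid_rel 3 `` {w}" if "w \<in> artin_words 3" for w
    using that by (simp add: braid_rel_def braid_eq.refl)
  show rep: "braid_representative 3 (braid_rel 3 `` {twisted_word n}) (?K n)"
    unfolding braid_representative_def
    using words(1) links(1) self by (auto intro!: braid_class_carrier bexI[of _ "twisted_word n"] link_isotopic_refl)
  show "3 \<le> m'" if "braid_representative m' \<beta>' (?K n)" for m' \<beta>'
    by (rule pure_braid_minimal_index[OF word_perm_twisted[of n] _ that]) simp
  \<comment> \<open>Moving the leading inverse powers to the end places them next to the powers that
    cancel them.\<close>
  have "link_isotopic (closed_braid 3 (?v @ ?u)) (closed_braid 3 (twisted_word n))"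
    using closed_braid_cyclic_permutation[of ?u ?v 3] words(1) word_perm_twisted
    by (simp add: twisted_word_def)
  then have "closed_braid 3 (?v @ ?u) \<in> ?K n"
    using links by (simp add: link_isotopic_sym)
  \<comment> \<open>The closure uses the unreduced word as representative, whereas
    \<open>nb_braid\<close> sees only its class, which is that of the square of
    \<open>\<sigma>\<^sub>1\<close>.\<close>
  then have rep0: "braid_representative 3 (braid_rel 3 `` {?v @ ?u}) (?K n)"
    unfolding braid_representative_def
    using words(2) self[OF words(2)] braid_class_carrier[OF words(2)] by (intro conjI bexI) simp_all
  have nb0: "nb_braid 3 (braid_rel 3 `` {?v @ ?u}) = 0"
  proof -
    let ?W = "[(1, 2, True), (1, 2, True)] :: band_letter list"
    have W: "?W \<in> band_words 3" by (simp add: band_words_def)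
    have x: "[(1, True), (1, True)] \<in> artin_words 3" "replicate n (2, True) \<in> artin_words 3"
      by (auto simp: artin_words_def)
    have "inverse_word (replicate n (2, True)) = ?u" by (simp add: inverse_word_def)
    then have "braid_eq 3 ([(1, True), (1, True)] @ (replicate n (2, True) @ ?u)) ([(1, True), (1, True)] @ [])"
      using braid_eq_inverse_word[OF x(2)] by (intro braid_eq.append braid_eq.refl x) simp
    then have "braid_rel 3 `` {?v @ ?u} = braid_rel 3 `` {[(1, True), (1, True)]}"
      using words(2) x(1) by (subst braid_class_eq_iff) auto
    also have "\<dots> = band_value 3 ?W"
      unfolding band_value_class[OF W] by (simp add: band_artin_def)
    finally show ?thesis
      using nb_braid_eqI[OF W HOL.refl] by (simp add: nb_word_def)
  qed
  \<comment> \<open>The value 0 is attained and is the least natural number.\<close>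
  have "nb_link (?K n) = 0"
    unfolding nb_link_def by (rule Least_equality) (use rep0 nb0 in blast, simp)
  then show "int (nb_braid 3 (braid_rel 3 `` {twisted_word n})) - int (nb_link (?K n)) = int n"
    using nb_twisted[OF n] by simp
qed

end
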